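(* Let $M$ be an irreducible Coxeter matrix of finite type over $I=\{1,\dots,n\}$ with $n\ge2$, labeled as described in the context. Then $$\mathbf p_M(t)=(1+t)\bigl(2\,\mathbf p_{M_J}(t)-\mathbf p_{M_{J'}}(t)\bigr),$$ where $J=I\setminus\{i\}$, $J'=I\setminus\{i,j\}$ with $(i,j)=(1,2)$ if $M$ is not of type $E$ and $(i,j)=(n-1,n-2)$ if $M$ is of type $E_n$, $n\in\{6,7,8\}$; moreover $\mathbf p_{A_0}(t)=1$ and $\mathbf p_{A_1}(t)=1+t$. In particular, $$|\mathbf P(M)|=\mathbf p_M(1)=\begin{cases}a_{|I|},&M\text{ is not of type }D,E,\\ d_{|I|},&M\text{ is of type }D,\\ e_6=4d_5-2a_4=856,&M\text{ is of type }E_6,\\ e_7=4e_6-2d_5=2928,&M\text{ is of type }E_7,\\ e_8=4e_7-2e_6=10000,&M\text{ is of type }E_8,\end{cases}$$ where $$a_n=\sum_{0\le k\le\lfloor n/2\rfloor}\binom n{2k}2^{n-k}\quad(n\ge0),\qquad d_n=2a_{n-1}+\sum_{0\le k\le\lfloor (n-1)/2\rfloor-1}\binom{n-2}{2k+1}2^{n-k}\quad(n\ge2).$$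
   Context: A Coxeter matrix over a finite set $I$ is a symmetric matrix $M=(m_{ij})_{i,j\in I}$ with $m_{ii}=1$, $m_{ij}\in\mathbb Z_{\ge2}\cup\{\infty\}$ for $i\neq j$; $W(M)$ is its Coxeter group with simple generators $s_i$; $M$ is of finite type if $W(M)$ is finite. The Coxeter graph of $M$ has vertex set $I$ and an edge between $i,j$ iff $m_{ij}>2$ (with label $m_{ij}$, the label $3$ being omitted). $M$ is irreducible if this graph is connected; $J\subset I$ is connected if the full subgraph on $J$ is connected and non-empty. $M_J=(m_{ij})_{i,j\in J}$ for $J\subset I$. $w_\circ^J$ is the longest element of $W_J(M)=\langle s_j:j\in J\rangle$. Labeling of irreducible finite types: $A_n$: path $1-2-\cdots-n$; $B_n$ ($n\ge 2$): the same path with the edge $\{n-1,n\}$ labeled $4$; $D_{n+1}$ ($n\ge3$): path $1-\cdots-(n-1)$ with $n$ and $n+1$ both joined to $n-1$; $E_n$ ($n=6,7,8$): path $1-\cdots-(n-1)$ with $n$ joined to $3$; $F_4$: path $1-2-3-4$ with $\{2,3\}$ labeled $4$; $H_n$ ($n=3,4$): path $1-\cdots-n$ with $\{n-1,n\}$ labeled $5$; $I_2(m)$: one edge labeled $m$. $A_0$ denotes the empty Coxeter matrix. For $M$ of finite type let $\mathbf P_0(M)=\{1\}$ and, for $k\ge1$, $\mathbf P_k(M)=\{w_\circ^{J_1}\cdots w_\circ^{J_k}:\ J_1,\dots,J_k\subset I\text{ pairwise disjoint and connected (non-empty)}\}\subset W(M)$ (product in the group). Put $\mathbf P(M)=\bigcup_{k\ge0}\mathbf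 P_k(M)$ and $\mathbf p_M(t)=\sum_{k\ge0}|\mathbf P_k(M)|t^k$. (The map $w\mapsto ww_\circ^I$ identifies $\mathbf P(M)$ with the set of multiparabolic elements of $W(M)$.) *)

theory Defs
  imports
    "HOL-Library.Extended_Nat"
    "HOL-Computational_Algebra.Polynomial"
    "HOL-Algebra.Generated_Groups"
begin

text \<open>A Coxeter matrix is given by its index set \<open>I\<close> and its entries \<open>M\<close>; only the entries
  with both indices in \<open>I\<close> are ever used. Hence the submatrix \<open>M\<^sub>J\<close> is simply \<open>M\<close>
  considered over the index set \<open>J\<close>.\<close>

definition coxeter_matrix :: "'i set \<Rightarrow> ('i \<Rightarrow> 'i \<Rightarrow> enat) \<Rightarrow> bool" where
  "coxeter_matrix I M \<longleftrightarrow> finite I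
     \<and> (\<forall>i\<in>I. M i i = 1)
     \<and> (\<forall>i\<in>I. \<forall>j\<in>I. M i j = M j i)
     \<and> (\<forall>i\<in>I. \<forall>j\<in>I. i \<noteq> j \<longrightarrow> 2 \<le> M i j)"

definition coxeter_edges :: "'i set \<Rightarrow> ('i \<Rightarrow> 'i \<Rightarrow> enat) \<Rightarrow> 'i set set" where
  "coxeter_edges I M = {{i, j} | i j. i \<in> I \<and> j \<in> I \<and> i \<noteq> j \<and> 2 < M i j}"

definition connected_subset :: "'i set \<Rightarrow> ('i \<Rightarrow> 'i \<Rightarrow> enat) \<Rightarrow> 'i set \<Rightarrow> bool" where
  "connected_subset I M J \<longleftrightarrow> J \<subseteq> I \<and> J \<noteq> {}
     \<and> (\<forall>i\<in>J. \<forall>j\<in>J. (i, j) \<in> {(x, y). {x, y} \<in> coxeter_edges J M}\<^sup>*)"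

definition irreducible_coxeter :: "'i set \<Rightarrow> ('i \<Rightarrow> 'i \<Rightarrow> enat) \<Rightarrow> bool" where
  "irreducible_coxeter I M \<longleftrightarrow> connected_subset I M I"

text \<open>Elements of the Coxeter group are classes of words over \<open>I\<close>, modulo the congruence
  generated by \<open>(s\<^sub>i s\<^sub>j)\<^bsup>m\<^esup> = 1\<close> for \<open>m = m\<^sub>i\<^sub>j < \<infinity>\<close>.
  Since this includes \<open>s\<^sub>i s\<^sub>i = 1\<close>, formal inverses of the generators are not needed.\<close>

inductive coxeter_eq :: "'i set \<Rightarrow> ('i \<Rightarrow> 'i \<Rightarrow> enat) \<Rightarrow> 'i list \<Rightarrow> 'i list \<Rightarrow> bool"
  for I :: "'i set" and M :: "'i \<Rightarrow> 'i \<Rightarrow> enat" where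
  refl: "w \<in> lists I \<Longrightarrow> coxeter_eq I M w w"
| sym: "coxeter_eq I M u v \<Longrightarrow> coxeter_eq I M v u"
| trans: "coxeter_eq I M u v \<Longrightarrow> coxeter_eq I M v w \<Longrightarrow> coxeter_eq I M u w"
| append: "coxeter_eq I M u u' \<Longrightarrow> coxeter_eq I M v v' \<Longrightarrow> coxeter_eq I M (u @ v) (u' @ v')"
| braid: "i \<in> I \<Longrightarrow> j \<in> I \<Longrightarrow> M i j = enat m \<Longrightarrow> coxeter_eq I M (concat (replicate m [i, j])) []"

definition coxeter_class :: "'i set \<Rightarrow> ('i \<Rightarrow> 'i \<Rightarrow> enat) \<Rightarrow> 'i list \<Rightarrow> 'i list set" where
  "coxeter_class I M w = {v. coxeter_eq I M w v}"

definition coxeter_group :: "'i set \<Rightarrow> ('i \<Rightarrow> 'i \<Rightarrow> enat) \<Rightarrow> 'i list set monoid" where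
  "coxeter_group I M =
     \<lparr>carrier = coxeter_class I M ` lists I,
      mult = (\<lambda>A B. {w. \<exists>u\<in>A. \<exists>v\<in>B. coxeter_eq I M (u @ v) w}),
      one = coxeter_class I M []\<rparr>"

lemma coxeter_eq_lists:
  "coxeter_eq I M u v \<Longrightarrow> u \<in> lists I \<and> v \<in> lists I"
proof (induction rule: coxeter_eq.induct)
  case (braid i j m)
  then show ?case by (simp add: in_lists_conv_set)
qed auto

lemma coxeter_class_eq_iff:
  "u \<in> lists I \<Longrightarrow> coxeter_class I M u = coxeter_class I M v \<longleftrightarrow> coxeter_eq I M u v"
  unfolding coxeter_class_def set_eq_iff mem_Collect_eq
  by (meson coxeter_eq.refl coxeter_eq.sym coxeter_eq.trans)

lemma coxeter_mult_class:
  assumes "u \<in> lists I" "v \<in> lists I"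
  shows "coxeter_class I M u \<otimes>\<^bsub>coxeter_group I M\<^esub> coxeter_class I M v = coxeter_class I M (u @ v)"
  using assms unfolding coxeter_group_def coxeter_class_def
  by (auto intro: coxeter_eq.refl coxeter_eq.trans coxeter_eq.append)

lemma coxeter_eq_rev:
  assumes "coxeter_matrix I M" "w \<in> lists I"
  shows "coxeter_eq I M (rev w @ w) []"
  using assms(2)
proof (induction w rule: list.induct)
  case Nil
  then show ?case by (auto intro: coxeter_eq.refl)
next
  case (Cons i w)
  have i: "i \<in> I" and w: "w \<in> lists I" "rev w \<in> lists I" using Cons.prems by (simp_all add: in_lists_conv_set)
  have "coxeter_eq I M [i, i] []"
    using coxeter_eq.braid[of i I i M 1] i assms(1) by (simp add: coxeter_matrix_def one_enat_def)
  then have "coxeter_eq I M (rev w @ [i, i] @ w) (rev w @ [] @ w)"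
    using w by (intro coxeter_eq.append coxeter_eq.refl)
  then show ?case using Cons.IH w coxeter_eq.trans by fastforce
qed

lemma group_coxeter_group:
  assumes "coxeter_matrix I M"
  shows "group (coxeter_group I M)"
proof (rule groupI)
  let ?G = "coxeter_group I M"
  have car: "carrier ?G = coxeter_class I M ` lists I" and one: "\<one>\<^bsub>?G\<^esub> = coxeter_class I M []"
    by (simp_all add: coxeter_group_def)
  show "\<one>\<^bsub>?G\<^esub> \<in> carrier ?G" by (auto simp: car one)
  show "x \<otimes>\<^bsub>?G\<^esub> y \<in> carrier ?G" if "x \<in> carrier ?G" "y \<in> carrier ?G" for x y
  proof -
    from that obtain u v where "u \<in> lists I" "v \<in> lists I"
      "x = coxeter_class I M u" "y = coxeter_class I M v" by (auto simp: car)
    then show ?thesis unfolding car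
      by (intro image_eqI[of _ _ "u @ v"]) (simp_all add: coxeter_mult_class del: lists_eq_set)
  qed
  show "x \<otimes>\<^bsub>?G\<^esub> y \<otimes>\<^bsub>?G\<^esub> z = x \<otimes>\<^bsub>?G\<^esub> (y \<otimes>\<^bsub>?G\<^esub> z)"
    if "x \<in> carrier ?G" "y \<in> carrier ?G" "z \<in> carrier ?G" for x y z
  proof -
    from that obtain u v w where "u \<in> lists I" "v \<in> lists I" "w \<in> lists I"
      "x = coxeter_class I M u" "y = coxeter_class I M v" "z = coxeter_class I M w"
      by (auto simp: car)
    then show ?thesis by (simp add: coxeter_mult_class)
  qed
  show "\<one>\<^bsub>?G\<^esub> \<otimes>\<^bsub>?G\<^esub> x = x" if "x \<in> carrier ?G" for x
  proof -
    from that obtain w where "w \<in> lists I" "x = coxeter_class I M w" by (auto simp: car)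
    then show ?thesis by (simp add: one coxeter_mult_class)
  qed
  show "\<exists>y\<in>carrier ?G. y \<otimes>\<^bsub>?G\<^esub> x = \<one>\<^bsub>?G\<^esub>" if "x \<in> carrier ?G" for x
  proof -
    from that obtain w where w: "w \<in> lists I" "x = coxeter_class I M w" by (auto simp: car)
    have r: "rev w \<in> lists I" using w(1) by (auto simp: in_lists_conv_set)
    have "coxeter_class I M (rev w) \<otimes>\<^bsub>?G\<^esub> x = \<one>\<^bsub>?G\<^esub>"
      using coxeter_eq_rev[OF assms w(1)] w r
      by (simp add: one coxeter_mult_class coxeter_class_eq_iff del: lists_eq_set)
    then show ?thesis using r by (auto simp: car)
  qed
qed

definition simple_gen :: "'i set \<Rightarrow> ('i \<Rightarrow> 'i \<Rightarrow> enat) \<Rightarrow> 'i \<Rightarrow> 'i list set" where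
  "simple_gen I M i = coxeter_class I M [i]"

definition finite_type :: "'i set \<Rightarrow> ('i \<Rightarrow> 'i \<Rightarrow> enat) \<Rightarrow> bool" where
  "finite_type I M \<longleftrightarrow> finite (carrier (coxeter_group I M))"

definition parabolic :: "'i set \<Rightarrow> ('i \<Rightarrow> 'i \<Rightarrow> enat) \<Rightarrow> 'i set \<Rightarrow> 'i list set set" where
  "parabolic I M J = generate (coxeter_group I M) (simple_gen I M ` J)"

text \<open>A group element is the set of all words representing it.\<close>

definition coxeter_length :: "'i list set \<Rightarrow> nat" where
  "coxeter_length x = (LEAST k. \<exists>w\<in>x. length w = k)"

definition longest :: "'i set \<Rightarrow> ('i \<Rightarrow> 'i \<Rightarrow> enat) \<Rightarrow> 'i set \<Rightarrow> 'i list set" where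
  "longest I M J = (THE w. w \<in> parabolic I M J
     \<and> (\<forall>v\<in>parabolic I M J. coxeter_length v \<le> coxeter_length w))"

definition coxeter_prod :: "'i set \<Rightarrow> ('i \<Rightarrow> 'i \<Rightarrow> enat) \<Rightarrow> 'i list set list \<Rightarrow> 'i list set" where
  "coxeter_prod I M xs = foldr (mult (coxeter_group I M)) xs \<one>\<^bsub>coxeter_group I M\<^esub>"

definition PP :: "nat \<Rightarrow> 'i set \<Rightarrow> ('i \<Rightarrow> 'i \<Rightarrow> enat) \<Rightarrow> 'i list set set" where
  "PP k I M = {coxeter_prod I M (map (longest I M) Js) | Js.
     length Js = k \<and> (\<forall>J\<in>set Js. connected_subset I M J) \<and> sorted_wrt disjnt Js}"

definition PPs :: "'i set \<Rightarrow> ('i \<Rightarrow> 'i \<Rightarrow> enat) \<Rightarrow> 'i list set set" where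
  "PPs I M = (\<Union>k. PP k I M)"

text \<open>The sum over all \<open>k\<close> is truncated at \<open>k = card I\<close>, which does not affect it: see
  \<open>coeff_pp\<close> below.\<close>

definition pp :: "'i set \<Rightarrow> ('i \<Rightarrow> 'i \<Rightarrow> enat) \<Rightarrow> int poly" where
  "pp I M = (\<Sum>k\<le>card I. monom (int (card (PP k I M))) k)"

lemma PP_0: "PP 0 I M = {\<one>\<^bsub>coxeter_group I M\<^esub>}"
  by (auto simp: PP_def coxeter_prod_def)

lemma disjnt_list_length_le:
  assumes "finite I" "\<forall>J\<in>set Js. J \<subseteq> I \<and> J \<noteq> {}" "sorted_wrt disjnt Js"
  shows "length Js \<le> card I"
proof -
  have "length Js \<le> card (\<Union>(set Js))"
    using assms(2,3)
  proof (induction Js)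
    case (Cons J Js)
    have fin: "finite J" "finite (\<Union>(set Js))"
      using Cons.prems(1) finite_subset[OF _ assms(1)] by auto
    have "J \<inter> \<Union>(set Js) = {}"
      using Cons.prems(2) by (auto simp: disjnt_def)
    then have "card (\<Union>(set (J # Js))) = card J + card (\<Union>(set Js))"
      using fin by (simp add: card_Un_disjoint)
    moreover have "card J \<noteq> 0" using Cons.prems(1) fin by simp
    ultimately show ?case using Cons by fastforce
  qed simp
  also have "\<dots> \<le> card I" using assms(1,2) by (intro card_mono) auto
  finally show ?thesis .
qed

lemma PP_empty:
  assumes "finite I" "card I < k"
  shows "PP k I M = {}"
proof -
  have False if "length Js = k" "\<forall>J\<in>set Js. connected_subset I M J" "sorted_wrt disjnt Js" for Js
    using disjnt_list_length_le[of I Js] that assms by (auto simp: connected_subset_def)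
  then show ?thesis by (auto simp: PP_def)
qed

lemma coeff_pp:
  assumes "finite I"
  shows "coeff (pp I M) k = int (card (PP k I M))"
  using PP_empty[OF assms] by (auto simp: pp_def coeff_sum not_le)

definition labeled_graph ::
  "'i set \<Rightarrow> ('i \<Rightarrow> 'i \<Rightarrow> enat) \<Rightarrow> 'i set set \<Rightarrow> ('i set \<Rightarrow> enat) \<Rightarrow> bool" where
  "labeled_graph I M E L \<longleftrightarrow> coxeter_matrix I M \<and> coxeter_edges I M = E
     \<and> (\<forall>i\<in>I. \<forall>j\<in>I. {i, j} \<in> E \<longrightarrow> M i j = L {i, j})"

definition path_edges :: "nat \<Rightarrow> nat set set" where
  "path_edges n = {{i, i + 1} | i. 1 \<le> i \<and> i < n}"

definition type_A :: "nat \<Rightarrow> (nat \<Rightarrow> nat \<Rightarrow> enat) \<Rightarrow> bool" where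
  "type_A n M \<longleftrightarrow> labeled_graph {1..n} M (path_edges n) (\<lambda>_. 3)"

definition type_B :: "nat \<Rightarrow> (nat \<Rightarrow> nat \<Rightarrow> enat) \<Rightarrow> bool" where
  "type_B n M \<longleftrightarrow> 2 \<le> n \<and> labeled_graph {1..n} M (path_edges n) ((\<lambda>_. 3)({n - 1, n} := 4))"

text \<open>In \<open>type_D\<close>, as everywhere, \<open>n\<close> is the size of the index set.\<close>

definition type_D :: "nat \<Rightarrow> (nat \<Rightarrow> nat \<Rightarrow> enat) \<Rightarrow> bool" where
  "type_D n M \<longleftrightarrow> 4 \<le> n
     \<and> labeled_graph {1..n} M (path_edges (n - 2) \<union> {{n - 2, n - 1}, {n - 2, n}}) (\<lambda>_. 3)"

definition type_E :: "nat \<Rightarrow> (nat \<Rightarrow> nat \<Rightarrow> enat) \<Rightarrow> bool" where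
  "type_E n M \<longleftrightarrow> n \<in> {6, 7, 8}
     \<and> labeled_graph {1..n} M (path_edges (n - 1) \<union> {{3, n}}) (\<lambda>_. 3)"

definition type_F :: "nat \<Rightarrow> (nat \<Rightarrow> nat \<Rightarrow> enat) \<Rightarrow> bool" where
  "type_F n M \<longleftrightarrow> n = 4 \<and> labeled_graph {1..n} M (path_edges n) ((\<lambda>_. 3)({2, 3} := 4))"

definition type_H :: "nat \<Rightarrow> (nat \<Rightarrow> nat \<Rightarrow> enat) \<Rightarrow> bool" where
  "type_H n M \<longleftrightarrow> n \<in> {3, 4} \<and> labeled_graph {1..n} M (path_edges n) ((\<lambda>_. 3)({n - 1, n} := 5))"

definition type_I2 :: "nat \<Rightarrow> (nat \<Rightarrow> nat \<Rightarrow> enat) \<Rightarrow> bool" where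
  "type_I2 n M \<longleftrightarrow> n = 2 \<and> (\<exists>m::nat. 3 \<le> m \<and> labeled_graph {1..n} M {{1, 2}} (\<lambda>_. enat m))"

definition standard_labeling :: "nat \<Rightarrow> (nat \<Rightarrow> nat \<Rightarrow> enat) \<Rightarrow> bool" where
  "standard_labeling n M \<longleftrightarrow>
     type_A n M \<or> type_B n M \<or> type_D n M \<or> type_E n M \<or> type_F n M \<or> type_H n M \<or> type_I2 n M"

definition a_seq :: "nat \<Rightarrow> nat" where
  "a_seq n = (\<Sum>k\<le>n div 2. (n choose (2 * k)) * 2 ^ (n - k))"

text \<open>Used for \<open>n \<ge> 2\<close> only; \<open>k < (n - 1) div 2\<close> stands for
  \<open>k \<le> \<lfloor>(n - 1) / 2\<rfloor> - 1\<close>, so that the sum is empty for \<open>n = 2\<close>.\<close>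

definition d_seq :: "nat \<Rightarrow> nat" where
  "d_seq n = 2 * a_seq (n - 1)
     + (\<Sum>k<(n - 1) div 2. ((n - 2) choose (2 * k + 1)) * 2 ^ (n - k))"

definition e6 :: int where "e6 = 4 * int (d_seq 5) - 2 * int (a_seq 4)"
definition e7 :: int where "e7 = 4 * e6 - 2 * int (d_seq 5)"
definition e8 :: int where "e8 = 4 * e7 - 2 * e6"

end

theory Submission
  imports Defs
begin

text \<open>
  Call two elements \<open>a, b\<close> adjacent if \<open>m\<^sub>a\<^sub>b > 2\<close>. Let \<open>w = w\<^sub>1 \<cdots> w\<^sub>k\<close> be a product of longest elements
  of pairwise disjoint connected \<open>J\<^sub>1, \<dots>, J\<^sub>k\<close>. Concatenating reduced words gives a reduced word of \<open>w\<close>, and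
  by Matsumoto's theorem its support \<open>K\<close> and the set \<open>R\<close> of ordered adjacent pairs \<open>(a, b)\<close> such that \<open>a\<close>
  occurs before \<open>b\<close> depend on \<open>w\<close> only. An adjacent pair inside one block occurs in both orders, a pair
  in different blocks only in the order of the blocks. Hence \<open>(K, R)\<close> determines the blocks
  and their order up to commuting factors, that is, it determines \<open>w\<close>. If \<open>x\<close> is a leaf
  with neighbour \<open>y\<close>, then a pair \<open>(K, R)\<close> over \<open>I - {x}\<close> with \<open>y \<in> K\<close> can be extended by \<open>x\<close> in three ways
  (new block before or after that of \<open>y\<close>, or enlarging the block of \<open>y\<close>), and in one way if \<open>y \<notin> K\<close>; counting by
  the number of blocks gives the recurrence.
\<close>

section \<open>Words and the exchange condition\<close>


text \<open>Matsumoto's theorem rests on two facts about words. The exchange condition is obtained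
  by counting, modulo 2, the reflections met along a word. That alternating words of length at most
  m_ab are reduced is harder: the relations bound the order of s_a s_b only from above. The lower
  bound comes from a linear action in which s_a s_b turns the a-b plane by twice the angle pi /
  m_ab. Reducedness of the concatenated words is itself a consequence of the invariance of the
  support: a failure would produce a reflection lying in two parabolic subgroups with disjoint
  supports. In the count, p_J - p_J' enumerates the pairs (K, R) over J = I - {x} with y in K. Each
  pair over J occurs once without x and once with {x} as a new block; those with y in K occur once
  more in each of these degrees. Hence p_I = (1 + t)(p_J + (p_J - p_J')). Only adjacency enters and
  no label, so all path diagrams of the same size give the same polynomial.\<close>

locale coxeter =
  fixes I :: "'i set" and M :: "'i \<Rightarrow> 'i \<Rightarrow> enat"
  assumes coxeter_matrix: "coxeter_matrix I M"
begin

section \<open>Calculus of words modulo the Coxeter relations\<close>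

abbreviation word_eq :: "'i list \<Rightarrow> 'i list \<Rightarrow> bool" (infix "\<approx>" 50) where
  "u \<approx> v \<equiv> coxeter_eq I M u v"

lemma M_diag: "i \<in> I \<Longrightarrow> M i i = 1"
  and M_commute: "i \<in> I \<Longrightarrow> j \<in> I \<Longrightarrow> M i j = M j i"
  and M_ge_2: "i \<in> I \<Longrightarrow> j \<in> I \<Longrightarrow> i \<noteq> j \<Longrightarrow> 2 \<le> M i j"
  and finite_I: "finite I"
  using coxeter_matrix by (auto simp: coxeter_matrix_def)

lemma word_eq_refl [simp]: "w \<approx> w \<longleftrightarrow> set w \<subseteq> I"
  using coxeter_eq_lists[of I M w w] coxeter_eq.refl[of w I M] by auto

lemma word_eq_set: "u \<approx> v \<Longrightarrow> set u \<subseteq> I" "u \<approx> v \<Longrightarrow> set v \<subseteq> I"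
  using coxeter_eq_lists by fastforce+

lemma word_eq_sym: "u \<approx> v \<longleftrightarrow> v \<approx> u"
  using coxeter_eq.sym by blast

lemma word_eq_cong_left: "u \<approx> v \<Longrightarrow> u \<approx> w \<longleftrightarrow> v \<approx> w"
  and word_eq_cong_right: "u \<approx> v \<Longrightarrow> w \<approx> u \<longleftrightarrow> w \<approx> v"
  by (meson coxeter_eq.sym coxeter_eq.trans)+

lemma word_eq_append_left: "u \<approx> v \<Longrightarrow> set w \<subseteq> I \<Longrightarrow> w @ u \<approx> w @ v"
  and word_eq_append_right: "u \<approx> v \<Longrightarrow> set w \<subseteq> I \<Longrightarrow> u @ w \<approx> v @ w"
  by (auto intro: coxeter_eq.append)

lemma word_eq_Cons: "u \<approx> v \<Longrightarrow> x \<in> I \<Longrightarrow> x # u \<approx> x # v"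
  using word_eq_append_left[of u v "[x]"] by simp

lemma word_eq_rev_left: "set w \<subseteq> I \<Longrightarrow> rev w @ w \<approx> []"
  and word_eq_rev_right: "set w \<subseteq> I \<Longrightarrow> w @ rev w \<approx> []"
  using coxeter_eq_rev[OF coxeter_matrix, of w] coxeter_eq_rev[OF coxeter_matrix, of "rev w"]
  by (auto simp: in_lists_conv_set subset_iff)

lemma append_word_eq_iff:
  assumes "set w \<subseteq> I"
  shows "w @ u \<approx> v \<longleftrightarrow> u \<approx> rev w @ v"
proof
  assume l: "w @ u \<approx> v"
  then have "set u \<subseteq> I" using word_eq_set(1) by fastforce
  then have "rev w @ w @ u \<approx> u"
    using word_eq_append_right[OF word_eq_rev_left[OF assms]] by fastforce
  moreover have "rev w @ w @ u \<approx> rev w @ v"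
    using l assms by (intro word_eq_append_left) auto
  ultimately show "u \<approx> rev w @ v" by (meson word_eq_cong_left)
next
  assume r: "u \<approx> rev w @ v"
  then have "set v \<subseteq> I" using word_eq_set(2) by fastforce
  then have "w @ rev w @ v \<approx> v"
    using word_eq_append_right[OF word_eq_rev_right[OF assms]] by fastforce
  moreover have "w @ u \<approx> w @ rev w @ v"
    using r assms by (intro word_eq_append_left) auto
  ultimately show "w @ u \<approx> v" by (meson word_eq_cong_left)
qed

lemma word_eq_revI: "u \<approx> v \<Longrightarrow> rev u \<approx> rev v"
proof -
  assume uv: "u \<approx> v"
  note s = word_eq_set[OF uv]
  have "v @ rev u \<approx> u @ rev u" using uv s by (intro word_eq_append_right) (auto simp: word_eq_sym)
  then have "v @ rev u \<approx> []" using word_eq_rev_right[OF s(1)] by (meson word_eq_cong_right)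
  then show ?thesis using append_word_eq_iff[OF s(2), of "rev u" "[]"] by simp
qed

lemma word_eq_rev_iff: "rev u \<approx> v \<longleftrightarrow> u \<approx> rev v"
  using word_eq_revI by fastforce

lemma word_eq_append_iff:
  assumes "set w \<subseteq> I"
  shows "u @ w \<approx> v \<longleftrightarrow> u \<approx> v @ rev w"
  using append_word_eq_iff[of "rev w" "rev u" "rev v"] assms word_eq_rev_iff[of "u @ w" "rev v"]
    word_eq_rev_iff[of u "w @ rev v"] word_eq_rev_iff[of "u @ w" v] word_eq_rev_iff[of u "v @ rev w"]
  by simp

lemma Cons_word_eq_iff: "x \<in> I \<Longrightarrow> x # u \<approx> v \<longleftrightarrow> u \<approx> x # v"
  using append_word_eq_iff[of "[x]"] by simp

lemma snoc_word_eq_iff: "x \<in> I \<Longrightarrow> u @ [x] \<approx> v \<longleftrightarrow> u \<approx> v @ [x]"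
  using word_eq_append_iff[of "[x]"] by simp

text \<open>Every relator has even length, so this is the sign character. It is used to see that a
  generator, and more generally a reflection, is not trivial.\<close>

lemma word_eq_length_parity: "u \<approx> v \<Longrightarrow> even (length u) \<longleftrightarrow> even (length v)"
proof (induction rule: coxeter_eq.induct)
  case (braid i j m)
  show ?case by (induction m) auto
qed auto

section \<open>Reduced words\<close>

definition reduced :: "'i list \<Rightarrow> bool" where
  "reduced w \<longleftrightarrow> set w \<subseteq> I \<and> (\<forall>v. w \<approx> v \<longrightarrow> length w \<le> length v)"

lemma reduced_set: "reduced w \<Longrightarrow> set w \<subseteq> I"
  by (simp add: reduced_def)

lemma reduced_le: "reduced w \<Longrightarrow> w \<approx> v \<Longrightarrow> length w \<le> length v"
  by (simp add: reduced_def)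

lemma reduced_cong: "reduced u \<Longrightarrow> u \<approx> v \<Longrightarrow> length v \<le> length u \<Longrightarrow> reduced v"
  unfolding reduced_def by (meson word_eq_set(2) coxeter_eq.trans le_trans)

lemma reduced_length_eq: "reduced u \<Longrightarrow> reduced v \<Longrightarrow> u \<approx> v \<Longrightarrow> length u = length v"
  by (meson reduced_le word_eq_sym le_antisym)

lemma reduced_Nil [simp]: "reduced []"
  by (simp add: reduced_def)

lemma reduced_appendD:
  assumes "reduced (u @ v)"
  shows "reduced u" "reduced v"
proof -
  have s: "set u \<subseteq> I" "set v \<subseteq> I" using reduced_set[OF assms] by auto
  show "reduced u"
    unfolding reduced_def
  proof (intro conjI allI impI s)
    fix w assume "u \<approx> w"
    then show "length u \<le> length w"
      using reduced_le[OF assms word_eq_append_right[OF _ s(2)]] by fastforce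
  qed
  show "reduced v"
    unfolding reduced_def
  proof (intro conjI allI impI s)
    fix w assume "v \<approx> w"
    then show "length v \<le> length w"
      using reduced_le[OF assms word_eq_append_left[OF _ s(1)]] by fastforce
  qed
qed

lemma reduced_ConsD: "reduced (x # w) \<Longrightarrow> reduced w"
  using reduced_appendD(2)[of "[x]" w] by simp

lemma ex_reduced:
  assumes "set w \<subseteq> I"
  shows "\<exists>v. reduced v \<and> w \<approx> v"
proof -
  obtain v where v: "w \<approx> v" "\<And>u. w \<approx> u \<Longrightarrow> length v \<le> length u"
    using ex_has_least_nat[of "\<lambda>v. w \<approx> v" w length] assms by auto
  have "reduced v"
    unfolding reduced_def using v word_eq_set(2)[OF v(1)] coxeter_eq.trans[OF v(1)] by blast
  then show ?thesis using v by blast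
qed

text \<open>The parity of the number of occurrences of \<open>t\<close> among the reflections
  \<open>x\<^sub>1 \<cdots> x\<^sub>k \<cdots> x\<^sub>1\<close> attached to a word; it depends only on the group element.\<close>

fun refl_parity :: "'i list \<Rightarrow> 'i list \<Rightarrow> bool" where
  "refl_parity [] t = False"
| "refl_parity (x # w) t = ((t \<approx> [x]) \<noteq> refl_parity w (x # t @ [x]))"

text \<open>Cocycle identity: inside \<open>u @ v\<close> the reflections of \<open>v\<close> appear
  conjugated by \<open>u\<close>, so they are compared with \<open>t\<close> after undoing this
  conjugation.\<close>

lemma refl_parity_append:
  "refl_parity (u @ v) t = (refl_parity u t \<noteq> refl_parity v (rev u @ t @ u))"
  by (induction u arbitrary: t) auto

lemma refl_parity_cong:
  "t \<approx> t' \<Longrightarrow> set w \<subseteq> I \<Longrightarrow> refl_parity w t = refl_parity w t'"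
proof (induction w arbitrary: t t')
  case (Cons x w)
  have "x # t @ [x] \<approx> x # t' @ [x]"
    using Cons.prems word_eq_append_left[OF word_eq_append_right[of t t' "[x]"], of "[x]"] by auto
  then show ?case
    using Cons word_eq_cong_left[OF Cons.prems(1)] by auto
qed auto

abbreviation wpow :: "'i list \<Rightarrow> nat \<Rightarrow> 'i list" where
  "wpow w n \<equiv> concat (replicate n w)"

lemma wpow_commute: "wpow w n @ w = w @ wpow w n"
  by (induction n) auto

lemma wpow_add: "wpow w (m + n) = wpow w m @ wpow w n"
  by (simp add: replicate_add)

lemma set_wpow: "set (wpow w n) \<subseteq> set w"
  by (induction n) auto

text \<open>The palindrome formed at the position after k letters is the alternating word (ij)^k i,
  so the parity becomes a count over k < 2n.\<close>

lemma refl_parity_wpow: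
  assumes "i \<in> I" "j \<in> I"
  shows "refl_parity (wpow [i, j] n) t = odd (\<Sum>k<2 * n. of_bool (t \<approx> wpow [i, j] k @ [i]) :: nat)"
proof (induction n arbitrary: t)
  case (Suc n)
  have shift: "(j # i # t @ [i, j] \<approx> wpow [i, j] k @ [i]) \<longleftrightarrow> (t \<approx> wpow [i, j] (Suc (Suc k)) @ [i])" for k
  proof -
    have "(j # i # t @ [i, j] \<approx> wpow [i, j] k @ [i]) \<longleftrightarrow> t @ [i, j] \<approx> [i, j] @ wpow [i, j] k @ [i]"
      using assms by (simp add: Cons_word_eq_iff)
    also have "\<dots> \<longleftrightarrow> t \<approx> [i, j] @ wpow [i, j] k @ [i, j, i]"
      using assms word_eq_append_iff[of "[i, j]" t] by simp
    also have "[i, j] @ wpow [i, j] k @ [i, j, i] = wpow [i, j] (Suc (Suc k)) @ [i]"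
      using wpow_commute[of k "[i, j]"] by simp
    finally show ?thesis .
  qed
  have "(i # t @ [i] \<approx> [j]) \<longleftrightarrow> t \<approx> [i, j, i]"
    using assms snoc_word_eq_iff[of i t] by (simp add: Cons_word_eq_iff)
  then have "refl_parity (wpow [i, j] (Suc n)) t
      = ((t \<approx> [i]) \<noteq> ((t \<approx> [i, j, i]) \<noteq> odd (\<Sum>k<2 * n. of_bool (t \<approx> wpow [i, j] (Suc (Suc k)) @ [i]) :: nat)))"
    using Suc.IH[of "j # i # t @ [i, j]"] shift by simp
  moreover have "(\<Sum>k<2 * Suc n. of_bool (t \<approx> wpow [i, j] k @ [i]) :: nat)
      = of_bool (t \<approx> [i]) + (of_bool (t \<approx> [i, j, i])
        + (\<Sum>k<2 * n. of_bool (t \<approx> wpow [i, j] (Suc (Suc k)) @ [i])))"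
    using sum.lessThan_Suc_shift[of "\<lambda>k. of_bool (t \<approx> wpow [i, j] k @ [i]) :: nat" "Suc (2 * n)"]
      sum.lessThan_Suc_shift[of "\<lambda>k. of_bool (t \<approx> wpow [i, j] (Suc k) @ [i]) :: nat" "2 * n"]
    by simp
  ultimately show ?case by auto
qed auto

text \<open>Prefixing (ij)^m does not change (ij)^k i in the group, so the positions k and m + k
  carry the same reflection and every reflection is counted an even number of times.\<close>

lemma refl_parity_braid:
  assumes "i \<in> I" "j \<in> I" "M i j = enat m"
  shows "\<not> refl_parity (wpow [i, j] m) t"
proof -
  have braid: "wpow [i, j] m \<approx> []" using assms by (rule coxeter_eq.braid)
  have "t \<approx> wpow [i, j] (m + k) @ [i] \<longleftrightarrow> t \<approx> wpow [i, j] k @ [i]" for k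
  proof -
    have "set (wpow [i, j] k @ [i]) \<subseteq> I" using set_wpow[of k "[i, j]"] assms by auto
    then have "wpow [i, j] (m + k) @ [i] \<approx> wpow [i, j] k @ [i]"
      using word_eq_append_right[OF braid, of "wpow [i, j] k @ [i]"] by (simp add: wpow_add)
    then show ?thesis by (rule word_eq_cong_right)
  qed
  then have "(\<Sum>k<m. of_bool (t \<approx> wpow [i, j] (m + k) @ [i]) :: nat)
      = (\<Sum>k<m. of_bool (t \<approx> wpow [i, j] k @ [i]))" by simp
  moreover have "(\<Sum>k<m + n. f k) = (\<Sum>k<m. f k) + (\<Sum>k<n. f (m + k))" for n and f :: "nat \<Rightarrow> nat"
    by (induction n) (simp_all add: add.assoc)
  ultimately show ?thesis
    unfolding refl_parity_wpow[OF assms(1,2)] by (simp add: mult_2)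
qed

lemma refl_parity_word_eq:
  "u \<approx> v \<Longrightarrow> set t \<subseteq> I \<Longrightarrow> refl_parity u t = refl_parity v t"
proof (induction arbitrary: t rule: coxeter_eq.induct)
  case (append u u' v v')
  have s: "set u \<subseteq> I" "set u' \<subseteq> I" "set v \<subseteq> I" "set v' \<subseteq> I"
    using append.hyps word_eq_set by blast+
  have "rev u @ t @ u \<approx> rev u' @ t @ u'"
    using append.hyps(1) append.prems by (auto intro!: coxeter_eq.append word_eq_revI)
  then show ?case
    using append s by (simp add: refl_parity_append refl_parity_cong)
next
  case (braid i j m)
  then show ?case using refl_parity_braid by simp
qed auto

lemma refl_parity_prefix:
  "refl_parity w t \<Longrightarrow> set w \<subseteq> I \<Longrightarrow> \<exists>p x q. w = p @ x # q \<and> t \<approx> p @ x # rev p"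
proof (induction w arbitrary: t)
  case (Cons x w)
  show ?case
  proof (cases "t \<approx> [x]")
    case True
    then show ?thesis by (intro exI[of _ "[]"] exI[of _ x] exI[of _ w]) auto
  next
    case False
    then obtain p y q where p: "w = p @ y # q" "x # t @ [x] \<approx> p @ y # rev p"
      using Cons.IH[of "x # t @ [x]"] Cons.prems by auto
    then have "t \<approx> x # p @ y # rev p @ [x]"
      using Cons.prems snoc_word_eq_iff[of x t] by (simp add: Cons_word_eq_iff)
    then show ?thesis using p by (intro exI[of _ "x # p"]) auto
  qed
qed auto

text \<open>If x = p y p^{-1}, then x p y = p because y is an involution: the letter y is deleted
  against x.\<close>

lemma exchange_delete:
  assumes "[x] \<approx> p @ y # rev p" "set q \<subseteq> I"
  shows "x # p @ y # q \<approx> p @ q" "p @ y # q \<approx> x # p @ q"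
proof -
  have s: "x \<in> I" "set p \<subseteq> I" "y \<in> I" using word_eq_set[OF assms(1)] by auto
  have 1: "x # p @ y # q \<approx> p @ y # rev p @ p @ y # q"
    using s assms word_eq_append_right[OF assms(1), of "p @ y # q"] by simp
  have "rev (p @ [y]) @ p @ [y] @ q \<approx> [] @ q"
    using s assms(2) word_eq_append_right[OF word_eq_rev_left[of "p @ [y]"], of q] by simp
  then have "p @ y # rev p @ p @ y # q \<approx> p @ q"
    using s word_eq_append_left[of "rev (p @ [y]) @ p @ [y] @ q" q p] by simp
  with 1 show "x # p @ y # q \<approx> p @ q" by (rule coxeter_eq.trans)
  then show "p @ y # q \<approx> x # p @ q" using s by (simp add: Cons_word_eq_iff)
qed

text \<open>The reflection form of the exchange condition: the letter \<open>y\<close> is the one to be deleted.\<close>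

lemma exchange:
  assumes "reduced w" "x \<in> I" "\<not> reduced (x # w)"
  shows "\<exists>p y q. w = p @ y # q \<and> [x] \<approx> p @ y # rev p"
proof (rule ccontr)
  assume no: "\<not> ?thesis"
  have w: "set w \<subseteq> I" using reduced_set assms(1) by blast
  then have "\<not> refl_parity w [x]" using refl_parity_prefix no by blast
  moreover have "[x, x] \<approx> []" using Cons_word_eq_iff[of x "[x]" "[]"] assms(2) by simp
  then have "x # [x] @ [x] \<approx> [x]" using word_eq_append_right[of "[x,x]" "[]" "[x]"] assms(2) by simp
  \<comment> \<open>The reflection x is counted once at the front of \<open>x # w\<close>, and no
    letter of \<open>w\<close> cancels it. The odd count survives in a reduced form v of this word,
    so some letter of v can be deleted against x; this would represent w by a word that is too
    short.\<close>
  ultimately have r: "refl_parity (x # w) [x]"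
    using refl_parity_cong[of "x # [x] @ [x]" "[x]" w] assms(2) w by simp
  obtain v where v: "reduced v" "x # w \<approx> v" using ex_reduced[of "x # w"] w assms(2) by auto
  have "refl_parity v [x]" using refl_parity_word_eq[OF v(2), of "[x]"] r assms(2) by auto
  then obtain p y q where p: "v = p @ y # q" "[x] \<approx> p @ y # rev p"
    using refl_parity_prefix reduced_set[OF v(1)] by blast
  have s: "set p \<subseteq> I" "y \<in> I" "set q \<subseteq> I" using reduced_set[OF v(1)] p(1) by auto
  have 1: "w \<approx> x # v" using v(2) assms(2) by (simp add: Cons_word_eq_iff)
  have "x # v \<approx> p @ q" using exchange_delete(1)[OF p(2) s(3)] p(1) by simp
  with 1 have wpq: "w \<approx> p @ q" by (rule coxeter_eq.trans)
  have "length v \<noteq> length (x # w)"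
    using reduced_cong[OF v(1), of "x # w"] v(2) assms(3) by (auto simp: word_eq_sym)
  moreover have "length v \<le> length (x # w)"
    using reduced_le[OF v(1), of "x # w"] v(2) by (simp add: word_eq_sym)
  ultimately have "length (p @ q) < length w" using p(1) by simp
  then show False using reduced_le[OF assms(1) wpq] by simp
qed

end

section \<open>The order of a product of two generators\<close>


context coxeter
begin

text \<open>The reflection v - 2 B(e_i, v) e_i of the Tits representation, in coordinates, with
  B(e_i, e_l) = - cos (pi / N i l). A diagonal entry 1 gives cos pi = -1, which turns the coordinate
  v i into - v i.\<close>

definition geom_refl :: "('i \<Rightarrow> 'i \<Rightarrow> nat) \<Rightarrow> 'i \<Rightarrow> ('i \<Rightarrow> real) \<Rightarrow> 'i \<Rightarrow> real" where
  "geom_refl N i v = v(i := v i + (\<Sum>l\<in>I. 2 * cos (pi / N i l) * v l))"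

text \<open>The contribution to coordinate i of the coordinates outside the i-j plane. Reflections
  in i and j leave it constant, so they act on the coordinates i and j by affine maps.\<close>

definition geom_input :: "('i \<Rightarrow> 'i \<Rightarrow> nat) \<Rightarrow> 'i \<Rightarrow> 'i \<Rightarrow> ('i \<Rightarrow> real) \<Rightarrow> real" where
  "geom_input N i j v = (\<Sum>l\<in>I - {i, j}. 2 * cos (pi / N i l) * v l)"

lemma geom_refl_plane:
  assumes "i \<in> I" "j \<in> I" "i \<noteq> j" "N i i = 1"
  shows "geom_refl N i v = v(i := - v i + 2 * cos (pi / N i j) * v j + geom_input N i j v)"
proof -
  have "(\<Sum>l\<in>I. f l) = f i + (f j + (\<Sum>l\<in>I - {i, j}. f l))" for f :: "'i \<Rightarrow> real"
    using assms finite_I sum.remove[of I i f] sum.remove[of "I - {i}" j f]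
    by (simp add: Diff_insert2[symmetric] insert_commute)
  then show ?thesis
    using assms(4) by (simp add: geom_refl_def geom_input_def algebra_simps)
qed

lemma sin_add_recurrence: "sin (t + x) = 2 * cos x * sin t - sin (t - x)" for t x :: real
  by (simp add: sin_add sin_diff)

text \<open>In the plane of \<open>i\<close> and \<open>j\<close> the coordinates produced by alternating reflections obey
  \<open>u\<^bsub>n+1\<^esub> = 2 cos \<theta> u\<^sub>n - u\<^bsub>n-1\<^esub>\<close> after translation by the fixed point \<open>(X, Y)\<close>.\<close>

lemma geom_refl_power:
  fixes N :: "'i \<Rightarrow> 'i \<Rightarrow> nat"
  assumes ij: "i \<in> I" "j \<in> I" "i \<noteq> j"
    and N: "N i i = 1" "N j j = 1" "N j i = N i j" "2 \<le> N i j"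
    and \<theta>: "\<theta> = pi / N i j"
    and XY: "2 * X = 2 * cos \<theta> * Y + geom_input N i j v" "2 * Y = 2 * cos \<theta> * X + geom_input N j i v"
  shows "((geom_refl N i \<circ> geom_refl N j) ^^ n) v = v(
    i := X + ((v i - X) * sin ((2 * real n + 1) * \<theta>) - (v j - Y) * sin (2 * real n * \<theta>)) / sin \<theta>,
    j := Y + ((v i - X) * sin (2 * real n * \<theta>) - (v j - Y) * sin ((2 * real n - 1) * \<theta>)) / sin \<theta>)"
proof (induction n)
  case 0
  have "sin \<theta> \<noteq> 0"
    using N(4) pi_gt_zero sin_gt_zero[of \<theta>] by (simp add: \<theta> field_simps)
  then show ?case by (auto simp: fun_eq_iff)
next
  case (Suc n)
  define A B s where "A = v i - X" and "B = v j - Y" and "s = (\<lambda>t::real. sin (t * \<theta>))"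
  have s0: "sin \<theta> \<noteq> 0"
    using N(4) pi_gt_zero sin_gt_zero[of \<theta>] by (simp add: \<theta> field_simps)
  have rec: "s (t + 1) = 2 * cos \<theta> * s t - s (t - 1)" for t
    unfolding s_def using sin_add_recurrence[of "t * \<theta>" \<theta>] by (simp add: algebra_simps)
  define x y where "x = X + (A * s (2 * real n + 1) - B * s (2 * real n)) / sin \<theta>"
    and "y = Y + (A * s (2 * real n) - B * s (2 * real n - 1)) / sin \<theta>"
  have IH: "((geom_refl N i \<circ> geom_refl N j) ^^ n) v = v(i := x, j := y)"
    using Suc.IH by (simp only: x_def y_def A_def B_def s_def)
  have inp: "geom_input N i j (v(i := x, j := z)) = geom_input N i j v"
    "geom_input N j i (v(i := x, j := z)) = geom_input N j i v" for z
    by (auto simp: geom_input_def intro!: sum.cong)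
  define y' where "y' = Y + (A * s (2 * real n + 2) - B * s (2 * real n + 1)) / sin \<theta>"
  define x' where "x' = X + (A * s (2 * real n + 3) - B * s (2 * real n + 2)) / sin \<theta>"
  have r: "s (2 * real n + 2) = 2 * cos \<theta> * s (2 * real n + 1) - s (2 * real n)"
    "s (2 * real n + 3) = 2 * cos \<theta> * s (2 * real n + 2) - s (2 * real n + 1)"
    "s (2 * real n - 1) = 2 * cos \<theta> * s (2 * real n) - s (2 * real n + 1)"
    "s (2 * real n) = 2 * cos \<theta> * s (2 * real n + 1) - s (2 * real n + 2)"
    using rec[of "2 * real n"] rec[of "2 * real n + 1"] rec[of "2 * real n + 2"]
    by (simp_all add: add.commute)
  have "- y + 2 * cos \<theta> * x + geom_input N j i v = 2 * Y - y + 2 * cos \<theta> * (x - X)"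
    using XY(2) by (simp add: algebra_simps)
  also have "\<dots> = y'"
    unfolding y'_def x_def y_def r(1,3) using s0 by (simp add: field_simps)
  finally have y': "geom_refl N j (v(i := x, j := y)) = v(i := x, j := y')"
    using geom_refl_plane[of j i N "v(i := x, j := y)"] ij N inp \<theta> by (simp add: fun_eq_iff)
  have "- x + 2 * cos \<theta> * y' + geom_input N i j v = 2 * X - x + 2 * cos \<theta> * (y' - Y)"
    using XY(1) by (simp add: algebra_simps)
  also have "\<dots> = x'"
    unfolding x'_def x_def y'_def r(2,4) using s0 by (simp add: field_simps)
  finally have x': "geom_refl N i (v(i := x, j := y')) = v(i := x', j := y')"
    using geom_refl_plane[of i j N "v(i := x, j := y')"] ij N inp \<theta> by (simp add: fun_eq_iff)
  have "((geom_refl N i \<circ> geom_refl N j) ^^ Suc n) v = v(i := x', j := y')"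
    using IH x' y' by simp
  moreover have "2 * real (Suc n) + 1 = 2 * real n + 3" "2 * real (Suc n) = 2 * real n + 2"
    "2 * real (Suc n) - 1 = 2 * real n + 1" by simp_all
  ultimately show ?case
    by (simp only: x'_def y'_def A_def B_def s_def)
qed

definition geom_act :: "('i \<Rightarrow> 'i \<Rightarrow> nat) \<Rightarrow> 'i list \<Rightarrow> ('i \<Rightarrow> real) \<Rightarrow> 'i \<Rightarrow> real" where
  "geom_act N w = foldr (geom_refl N) w"

lemma geom_act_simps [simp]:
  "geom_act N [] = id" "geom_act N (i # w) = geom_refl N i \<circ> geom_act N w"
  "geom_act N (u @ w) = geom_act N u \<circ> geom_act N w"
  by (auto simp: geom_act_def fun_eq_iff)

lemma geom_act_wpow: "geom_act N (wpow [i, j] n) = (geom_refl N i \<circ> geom_refl N j) ^^ n"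
  by (induction n) (auto simp: o_assoc)

text \<open>Relations exist only for finite entries of \<open>M\<close>, so every \<open>N\<close>
  that agrees with these gives an action of the same group, while sin (pi / N i j) stays nonzero for
  distinct i and j.\<close>

definition finite_approx :: "('i \<Rightarrow> 'i \<Rightarrow> nat) \<Rightarrow> bool" where
  "finite_approx N \<longleftrightarrow> (\<forall>i\<in>I. N i i = 1) \<and> (\<forall>i\<in>I. \<forall>j\<in>I. N i j = N j i)
    \<and> (\<forall>i\<in>I. \<forall>j\<in>I. i \<noteq> j \<longrightarrow> 2 \<le> N i j)
    \<and> (\<forall>i\<in>I. \<forall>j\<in>I. \<forall>m. M i j = enat m \<longrightarrow> N i j = m)"

text \<open>For distinct i and j the product of the two reflections turns the i-j plane about a
  fixed point by twice the angle pi / N i j, so its N i j-th power is a full turn: the arguments of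
  the sines shift by 2 pi. For i = j the claim is that a reflection is an involution.\<close>

lemma geom_act_braid:
  assumes N: "finite_approx N" and ij: "i \<in> I" "j \<in> I"
  shows "geom_act N (wpow [i, j] (N i j)) = id"
proof (cases "i = j")
  case True
  have "geom_refl N i (geom_refl N i v) = v" for v
  proof -
    have "(\<Sum>l\<in>I. 2 * cos (pi / N i l) * (v(i := a)) l)
        = - 2 * a + (\<Sum>l\<in>I - {i}. 2 * cos (pi / N i l) * v l)" for a
      using N ij finite_I sum.remove[of I i "\<lambda>l. 2 * cos (pi / N i l) * (v(i := a)) l"]
      by (simp add: finite_approx_def)
    from this this[of "v i"] show ?thesis by (simp add: geom_refl_def)
  qed
  moreover have "N i j = 1" using N ij True by (simp add: finite_approx_def)
  ultimately show ?thesis using True by (auto simp: fun_eq_iff)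
next
  case False
  define \<theta> where "\<theta> = pi / N i j"
  have Nij: "N i i = 1" "N j j = 1" "N j i = N i j" "2 \<le> N i j"
    using N ij False by (auto simp: finite_approx_def)
  have m: "N i j * \<theta> = pi" using Nij by (simp add: \<theta>_def)
  have s0: "0 < sin \<theta>"
    using Nij(4) pi_gt_zero by (intro sin_gt_zero) (simp_all add: \<theta>_def field_simps)
  have c: "1 - (cos \<theta>)\<^sup>2 \<noteq> 0" using s0 sin_squared_eq[of \<theta>] by auto
  show ?thesis
  proof
    fix v
    define P Q where "P = geom_input N i j v" and "Q = geom_input N j i v"
    \<comment> \<open>The centre of the rotation. It solves the linear system \<open>XY\<close>,
      whose determinant is a multiple of 1 - cos^2 = sin^2 and hence nonzero.\<close>
    define X Y where "X = (P + cos \<theta> * Q) / (2 * (1 - (cos \<theta>)\<^sup>2))"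
      and "Y = (Q + cos \<theta> * P) / (2 * (1 - (cos \<theta>)\<^sup>2))"
    have XY: "2 * X = 2 * cos \<theta> * Y + P" "2 * Y = 2 * cos \<theta> * X + Q"
      using c unfolding X_def Y_def by (simp_all add: divide_simps) (simp_all add: algebra_simps power2_eq_square)
    have "sin ((2 * real (N i j) + 1) * \<theta>) = sin \<theta>" "sin (2 * real (N i j) * \<theta>) = 0"
      "sin ((2 * real (N i j) - 1) * \<theta>) = - sin \<theta>"
    proof -
      have "(2 * real (N i j) + 1) * \<theta> = \<theta> + 2 * pi" "2 * real (N i j) * \<theta> = 2 * pi"
        "(2 * real (N i j) - 1) * \<theta> = - \<theta> + 2 * pi"
        using m by (simp_all add: algebra_simps)
      then show "sin ((2 * real (N i j) + 1) * \<theta>) = sin \<theta>" "sin (2 * real (N i j) * \<theta>) = 0"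
        "sin ((2 * real (N i j) - 1) * \<theta>) = - sin \<theta>" by (simp_all only: sin_periodic sin_two_pi sin_minus)
    qed
    then show "geom_act N (wpow [i, j] (N i j)) v = id v"
      unfolding geom_act_wpow
      using geom_refl_power[OF ij False Nij \<theta>_def XY[unfolded P_def Q_def]] s0
      by (simp add: fun_eq_iff)
  qed
qed

lemma geom_act_word_eq:
  assumes "finite_approx N"
  shows "u \<approx> v \<Longrightarrow> geom_act N u = geom_act N v"
proof (induction rule: coxeter_eq.induct)
  case (braid i j m)
  then have "N i j = m" using assms by (auto simp: finite_approx_def)
  then show ?case using geom_act_braid[OF assms braid(1,2)] by simp
qed auto

text \<open>If (s_i s_j)^n acts trivially, then n times the rotation angle 2 pi / m is a multiple of
  2 pi, which is impossible for 0 < n < m.\<close>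

lemma wpow_order:
  assumes ij: "i \<in> I" "j \<in> I" "i \<noteq> j" and n: "0 < n" and eq: "wpow [i, j] n \<approx> []"
  shows "M i j \<le> enat n"
proof (rule ccontr)
  assume "\<not> M i j \<le> enat n"
  then have lt: "enat n < M i j" by simp
  text \<open>No relation involves an infinite entry of \<open>M\<close>, so any sufficiently large value may replace it.\<close>
  define N where "N a b = (case M a b of enat m \<Rightarrow> m | \<infinity> \<Rightarrow> n + 2)" for a b
  have N: "finite_approx N"
    unfolding finite_approx_def
  proof (intro conjI ballI impI allI)
    fix a b assume "a \<in> I" "b \<in> I" "a \<noteq> b"
    from M_ge_2[OF this] show "2 \<le> N a b"
      by (cases "M a b") (auto simp: N_def numeral_eq_enat)
  qed (auto simp: N_def M_diag M_commute one_enat_def)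
  have Nij: "N i i = 1" "N j j = 1" "N j i = N i j" "2 \<le> N i j"
    using N ij by (auto simp: finite_approx_def)
  have nN: "n < N i j" using lt by (cases "M i j") (auto simp: N_def)
  define \<theta> where "\<theta> = pi / N i j"
  \<comment> \<open>The basis vector e_i has no component outside the i-j plane, so the fixed point
    is the origin and the formula for the powers reduces to two quotients of sines.\<close>
  define v where "v = (\<lambda>l. if l = i then 1 else 0 :: real)"
  have inp: "2 * 0 = 2 * cos \<theta> * 0 + geom_input N i j v" "2 * 0 = 2 * cos \<theta> * 0 + geom_input N j i v"
    by (auto simp: geom_input_def v_def intro!: sum.neutral)
  have "geom_act N (wpow [i, j] n) v = v" using geom_act_word_eq[OF N eq] by simp
  then have "v i = sin ((2 * real n + 1) * \<theta>) / sin \<theta>" "v j = sin (2 * real n * \<theta>) / sin \<theta>"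
    using fun_cong[OF geom_refl_power[OF ij Nij \<theta>_def inp, of n], of i]
      fun_cong[OF geom_refl_power[OF ij Nij \<theta>_def inp, of n], of j] ij(3)
    by (simp_all add: geom_act_wpow v_def)
  moreover have s0: "0 < sin \<theta>"
    using Nij(4) pi_gt_zero by (intro sin_gt_zero) (simp_all add: \<theta>_def field_simps)
  ultimately have s: "sin (2 * real n * \<theta> + \<theta>) = sin \<theta>" "sin (2 * real n * \<theta>) = 0"
    using ij(3) by (simp_all add: v_def field_simps)
  have "cos (2 * real n * \<theta>) * sin \<theta> = sin \<theta>" using s by (simp add: sin_add)
  then have "cos (2 * real n * \<theta>) = 1" using s0 by simp
  moreover have "0 < n * \<theta>" "n * \<theta> < pi"
    using n nN pi_gt_zero by (simp_all add: \<theta>_def field_simps)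
  then have "0 < sin (n * \<theta>)" by (rule sin_gt_zero)
  moreover have "cos (2 * real n * \<theta>) = 1 - 2 * (sin (n * \<theta>))\<^sup>2"
    using cos_double_sin[of "n * \<theta>"] by (simp add: mult.assoc)
  ultimately show False by simp
qed

end

section \<open>Matsumoto's theorem and parabolic subgroups\<close>


fun alt :: "nat \<Rightarrow> 'a \<Rightarrow> 'a \<Rightarrow> 'a list" where
  "alt 0 a b = []"
| "alt (Suc n) a b = a # alt n b a"

lemma length_alt [simp]: "length (alt n a b) = n"
  by (induction n a b rule: alt.induct) auto

lemma set_alt_subset: "set (alt n a b) \<subseteq> {a, b}"
  by (induction n a b rule: alt.induct) auto

lemma set_alt: "2 \<le> n \<Longrightarrow> set (alt n a b) = {a, b}"
  using set_alt_subset[of n a b] by (cases "(n, a, b)" rule: alt.cases; cases "n - 1") auto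

lemma alt_snoc: "alt (Suc n) a b = alt n a b @ [if even n then a else b]"
  by (induction n a b rule: alt.induct) auto

text \<open>Connects the two forms of a relation, (ab)^m = 1 and the equality of the two alternating
  words of length m, since the reverse of a word represents its inverse.\<close>

lemma alt_append_rev_alt: "alt m a b @ rev (alt m b a) = concat (replicate m [a, b])"
proof -
  have shift: "a # concat (replicate n [b, a]) @ [b] = concat (replicate (Suc n) [a, b])" for n and a b :: 'a
    by (induction n) auto
  show ?thesis
  proof (induction m a b rule: alt.induct)
    case (2 n a b)
    have "alt (Suc n) a b @ rev (alt (Suc n) b a) = a # (alt n b a @ rev (alt n a b)) @ [b]" by simp
    then show ?case unfolding 2 using shift[of a n b] by simp
  qed simp
qed

lemma alt_double: "alt (2 * n) a b = concat (replicate n [a, b])"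
  by (induction n) auto

text \<open>The reflections attached to an alternating word are alternating words of odd length.
  This turns the outcome of the exchange condition into a statement about a power of ab.\<close>

lemma alt_prefix_palindrome:
  "alt n a b = p @ y # q \<Longrightarrow> p @ y # rev p = alt (Suc (2 * length p)) a b"
proof (induction p arbitrary: n a b)
  case Nil
  then show ?case by (cases n) auto
next
  case (Cons x p)
  then obtain n' where n: "x = a" "alt n' b a = p @ y # q" by (cases n) auto
  have "x # (p @ y # rev p) @ [x] = a # alt (Suc (2 * length p)) b a @ [a]"
    unfolding Cons.IH[OF n(2)] n(1) ..
  also have "\<dots> = alt (Suc (2 * length (x # p))) a b"
    using alt_snoc[of "Suc (Suc (2 * length p))" a b] by simp
  finally show ?case using n(1) by simp
qed

fun pairs :: "'a list \<Rightarrow> ('a \<times> 'a) set" where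
  "pairs [] = {}"
| "pairs (x # w) = {x} \<times> set w \<union> pairs w"

lemma pairs_append: "pairs (u @ v) = pairs u \<union> set u \<times> set v \<union> pairs v"
  by (induction u) auto

lemma pairs_subset: "pairs w \<subseteq> set w \<times> set w"
  by (induction w) auto

definition adj :: "('i \<Rightarrow> 'i \<Rightarrow> enat) \<Rightarrow> ('i \<times> 'i) set" where
  "adj M = {(a, b). a \<noteq> b \<and> 2 < M a b}"

context coxeter
begin

lemma adj_commute: "a \<in> I \<Longrightarrow> b \<in> I \<Longrightarrow> (a, b) \<in> adj M \<longleftrightarrow> (b, a) \<in> adj M"
  using M_commute[of a b] by (auto simp: adj_def)

lemma alt_braid:
  assumes "a \<in> I" "b \<in> I" "M a b = enat m"
  shows "alt m a b \<approx> alt m b a"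
proof -
  have "alt m a b @ rev (alt m b a) \<approx> []"
    unfolding alt_append_rev_alt using assms by (rule coxeter_eq.braid)
  then show ?thesis
    using word_eq_append_iff[of "rev (alt m b a)" "alt m a b" "[]"] set_alt_subset[of m b a] assms by auto
qed

text \<open>If prefixing a destroyed reducedness, exchange would identify a with an alternating word
  of length 2l + 1 that begins with b, where l < n. Then (ab)^(l+1) = 1, which contradicts the order
  of s_a s_b.\<close>

lemma reduced_alt:
  assumes "a \<in> I" "b \<in> I" "a \<noteq> b" "enat n \<le> M a b"
  shows "reduced (alt n a b)"
  using assms
proof (induction n a b rule: alt.induct)
  case (2 n a b)
  have le: "enat n \<le> M b a"
    using "2.prems" M_commute[of a b] by (metis enat_ord_simps(1) le_SucI order.refl order.trans)
  show ?case
  proof (rule ccontr)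
    assume "\<not> reduced (alt (Suc n) a b)"
    moreover have "reduced (alt n b a)" using 2 le by auto
    ultimately obtain p y q where p: "alt n b a = p @ y # q" "[a] \<approx> p @ y # rev p"
      using exchange[of "alt n b a" a] "2.prems"(1) by auto
    have len: "length p < n" using arg_cong[OF p(1), of length] by simp
    have "[a] \<approx> alt (Suc (2 * length p)) b a"
      using p alt_prefix_palindrome[OF p(1)] by simp
    then have "wpow [a, b] (Suc (length p)) \<approx> []"
      using "2.prems"(1) Cons_word_eq_iff[of a "[]"] alt_double[of "Suc (length p)" a b]
      by (simp add: word_eq_sym)
    then have "M a b \<le> enat (Suc (length p))"
      using wpow_order "2.prems" by blast
    then show False using len "2.prems"(4) by (metis enat_ord_simps(1) linorder_not_le not_less_eq order.trans)
  qed
qed simp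

text \<open>Both a and b shorten w, so alternating letters can be pulled to the front one at a time.
  The letter deleted in exchange lies behind the alternating part, because that part stays reduced
  when the next letter is put in front of it.\<close>

lemma alt_prefix:
  assumes "reduced w" "a \<in> I" "b \<in> I" "a \<noteq> b" "enat n \<le> M a b"
    and "\<not> reduced (a # w)" "\<not> reduced (b # w)"
  shows "\<exists>r. reduced (alt n a b @ r) \<and> w \<approx> alt n a b @ r"
  using assms(2-)
proof (induction n a b rule: alt.induct)
  case (1 a b)
  then show ?case using assms(1) reduced_set[OF assms(1)] by (intro exI[of _ w]) auto
next
  case (2 n a b)
  have "enat n \<le> M b a"
    using "2.prems" M_commute[of a b] by (metis enat_ord_simps(1) le_SucI order.refl order.trans)
  then obtain r where r: "reduced (alt n b a @ r)" "w \<approx> alt n b a @ r"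
    using "2.IH" "2.prems" by auto
  have "\<not> reduced (a # alt n b a @ r)"
    using reduced_cong[OF _ coxeter_eq.sym[OF word_eq_Cons[OF r(2)]]] "2.prems"(1,5)
      reduced_length_eq[OF assms(1) r] by auto
  then obtain p y q where p: "alt n b a @ r = p @ y # q" "[a] \<approx> p @ y # rev p"
    using exchange[OF r(1)] "2.prems"(1) by blast
  have "\<exists>r1 r2. p = alt n b a @ r1 \<and> r = r1 @ y # r2 \<and> q = r2"
  proof (rule ccontr)
    assume "\<not> ?thesis"
    then obtain q1 where q1: "alt n b a = p @ y # q1"
      using p(1) by (auto simp: append_eq_append_conv2 append_eq_Cons_conv)
    have red: "reduced (alt (Suc n) a b)" using "2.prems" by (intro reduced_alt)
    have "a # p @ y # q1 \<approx> p @ q1"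
      using reduced_set[OF red] q1 by (intro exchange_delete(1) p(2)) auto
    then have "length (alt (Suc n) a b) \<le> length (p @ q1)"
      using q1 by (intro reduced_le[OF red]) simp
    then show False using arg_cong[OF q1, of length] by simp
  qed
  then obtain r1 where r1: "p = alt n b a @ r1" "r = r1 @ y # q" by blast
  have "alt n b a @ r \<approx> a # p @ q"
    using exchange_delete(2)[OF p(2), of q] reduced_set[OF r(1)] p(1) by simp
  then have eq: "w \<approx> alt (Suc n) a b @ r1 @ q"
    using r(2) r1 coxeter_eq.trans by fastforce
  moreover have "length (alt (Suc n) a b @ r1 @ q) \<le> length w"
    using reduced_length_eq[OF assms(1) r] r1 by simp
  ultimately show ?case using reduced_cong[OF assms(1)] by blast
qed

text \<open>Braid moves only, without insertion or deletion of a square, so the length is preserved.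
  The tail \<open>w\<close> and the rule \<open>Cons\<close> supply the right and the left
  context.\<close>

inductive braid_eq :: "'i list \<Rightarrow> 'i list \<Rightarrow> bool" where
  refl: "braid_eq w w"
| trans: "braid_eq u v \<Longrightarrow> braid_eq v w \<Longrightarrow> braid_eq u w"
| Cons: "braid_eq u v \<Longrightarrow> braid_eq (x # u) (x # v)"
| braid: "a \<in> I \<Longrightarrow> b \<in> I \<Longrightarrow> a \<noteq> b \<Longrightarrow> M a b = enat m \<Longrightarrow> braid_eq (alt m a b @ w) (alt m b a @ w)"

lemma not_reduced_Cons:
  assumes "reduced w" "w \<approx> x # v" "length v < length w"
  shows "\<not> reduced (x # w)"
proof
  assume r: "reduced (x # w)"
  have "x # w \<approx> v"
    using Cons_word_eq_iff[of x w v] reduced_set[OF r] assms(2) by simp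
  from reduced_le[OF r this] show False using assms(3) by simp
qed

text \<open>If the first letters x and y differ, the element is shortened by both. It is therefore
  represented by two reduced words that begin with the two alternating words of length m and share a
  rest r. These differ by one braid move, and each has the same first letter as one of the given
  words; after deleting it the induction hypothesis applies.\<close>

theorem matsumoto: "reduced u \<Longrightarrow> reduced v \<Longrightarrow> u \<approx> v \<Longrightarrow> braid_eq u v"
proof (induction "length u" arbitrary: u v rule: less_induct)
  case less
  show ?case
  proof (cases u)
    case Nil
    then show ?thesis using reduced_length_eq[OF less.prems] by (auto intro: braid_eq.refl)
  next
    case (Cons x u')
    obtain y v' where v: "v = y # v'" using reduced_length_eq[OF less.prems] Cons by (cases v) auto
    have I: "x \<in> I" "y \<in> I" "set u' \<subseteq> I" "set v' \<subseteq> I"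
      using reduced_set[OF less.prems(1)] reduced_set[OF less.prems(2)] Cons v by auto
    have red: "reduced u'" "reduced v'" using less.prems(1,2) Cons v reduced_ConsD by blast+
    have len: "length u = length v" using reduced_length_eq[OF less.prems] .
    show ?thesis
    proof (cases "x = y")
      case True
      have "[x, x] @ v' \<approx> [] @ v'"
        using I word_eq_rev_left[of "[x]"] by (intro word_eq_append_right) auto
      then have "u' \<approx> v'"
        using less.prems(3) Cons v True I Cons_word_eq_iff[of x u' v]
        by (simp add: word_eq_cong_right)
      then show ?thesis using less.hyps[of u' v'] red Cons v True by (auto intro: braid_eq.Cons)
    next
      case False
      have nx: "\<not> reduced (x # u)"
        using not_reduced_Cons[OF less.prems(1), of x u'] reduced_set[OF less.prems(1)] Cons by auto
      have ny: "\<not> reduced (y # u)"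
        using not_reduced_Cons[OF less.prems(1), of y v'] less.prems(3) v len by auto
      have "M x y \<noteq> \<infinity>"
      proof
        assume "M x y = \<infinity>"
        \<comment> \<open>With an infinite entry the alternating prefix may have any length; one
          that is longer than \<open>u\<close> is absurd.\<close>
        then obtain r where r: "reduced (alt (Suc (length u)) x y @ r)" "u \<approx> alt (Suc (length u)) x y @ r"
          using alt_prefix[OF less.prems(1) I(1,2) False _ nx ny] by fastforce
        show False using reduced_length_eq[OF less.prems(1) r] by simp
      qed
      then obtain m where m: "M x y = enat m" by auto
      have m2: "2 \<le> m" using M_ge_2[OF I(1,2) False] m by (simp add: numeral_eq_enat)
      then obtain k where k: "m = Suc k" by (cases m) auto
      obtain r where r: "reduced (alt m x y @ r)" "u \<approx> alt m x y @ r"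
        using alt_prefix[OF less.prems(1) I(1,2) False _ nx ny, of m] m by auto
      have rI: "set r \<subseteq> I" using reduced_set[OF r(1)] by simp
      have ab: "alt m x y @ r \<approx> alt m y x @ r"
        using alt_braid[OF I(1,2) m] rI by (rule word_eq_append_right)
      then have r': "reduced (alt m y x @ r)" using reduced_cong[OF r(1)] by simp
      have cancel: "s \<approx> t" if "z # s \<approx> z # t" for z s t
      proof -
        have "z \<in> I" "set t \<subseteq> I" using word_eq_set[OF that] by auto
        then have "[z, z] @ t \<approx> [] @ t"
          using word_eq_rev_left[of "[z]"] by (intro word_eq_append_right) auto
        then show ?thesis
          using that \<open>z \<in> I\<close> Cons_word_eq_iff[of z s "z # t"] by (simp add: word_eq_cong_right)
      qed
      have "u' \<approx> alt k y x @ r" using cancel[of x u'] r(2) Cons k by simp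
      moreover have "reduced (alt k y x @ r)" using r(1) k reduced_ConsD by simp
      ultimately have "braid_eq u' (alt k y x @ r)"
        using less.hyps[of u'] red Cons by simp
      then have 1: "braid_eq u (alt m x y @ r)" using Cons k by (auto intro: braid_eq.Cons)
      have "u \<approx> alt m y x @ r" using r(2) ab by (rule coxeter_eq.trans)
      then have "alt m y x @ r \<approx> v" using less.prems(3) by (meson word_eq_cong_left)
      then have "alt k x y @ r \<approx> v'" using cancel[of y _ v'] v k by simp
      moreover have "reduced (alt k x y @ r)" using r' k reduced_ConsD by simp
      moreover have "length (alt k x y @ r) < length u"
        using reduced_length_eq[OF less.prems(1) r] k by simp
      ultimately have "braid_eq (alt k x y @ r) v'"
        using less.hyps red by blast
      then have 2: "braid_eq (alt m y x @ r) v" using v k by (auto intro: braid_eq.Cons)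
      show ?thesis
        using 1 2 braid_eq.braid[OF I(1,2) False m] braid_eq.trans by blast
    qed
  qed
qed

text \<open>The reason for recording adjacent pairs only: for m > 2 an alternating word of length m
  contains a and b in both orders, and for m = 2, where a move reverses their order, the pair is not
  adjacent.\<close>

lemma pairs_alt_adj:
  assumes "a \<in> I" "b \<in> I" "a \<noteq> b" "M a b = enat m"
  shows "pairs (alt m a b) \<inter> adj M = {(a, b), (b, a)} \<inter> adj M"
proof (cases "2 < m")
  case True
  then obtain k where "m = Suc (Suc (Suc k))"
    by (metis less_imp_Suc_add add_2_eq_Suc add_Suc_right)
  then have "{(a, b), (b, a)} \<subseteq> pairs (alt m a b)" by auto
  moreover have "pairs (alt m a b) \<subseteq> {a, b} \<times> {a, b}"
    using pairs_subset[of "alt m a b"] set_alt_subset[of m a b] by blast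
  ultimately show ?thesis by (auto simp: adj_def)
next
  case False
  then have "(a, b) \<notin> adj M" "(b, a) \<notin> adj M"
    using assms M_commute[of a b] by (auto simp: adj_def numeral_eq_enat)
  moreover have "pairs (alt m a b) \<subseteq> {a, b} \<times> {a, b}"
    using pairs_subset[of "alt m a b"] set_alt_subset[of m a b] by blast
  ultimately show ?thesis by (auto simp: adj_def)
qed

lemma braid_eq_invariants:
  "braid_eq u v \<Longrightarrow> set u = set v \<and> pairs u \<inter> adj M = pairs v \<inter> adj M"
proof (induction rule: braid_eq.induct)
  case (braid a b m w)
  have "2 \<le> m" using M_ge_2[OF braid(1-3)] braid(4) by (simp add: numeral_eq_enat)
  then have s: "set (alt m a b) = {a, b}" "set (alt m b a) = {a, b}" by (auto simp: set_alt)
  have "M b a = enat m" using braid M_commute by simp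
  then have "pairs (alt m a b) \<inter> adj M = pairs (alt m b a) \<inter> adj M"
    using pairs_alt_adj[OF braid] pairs_alt_adj[of b a m] braid by auto
  then show ?case using s by (simp add: pairs_append Int_Un_distrib2)
qed (auto simp: Int_Un_distrib2)

lemma reduced_invariants:
  assumes "reduced u" "reduced v" "u \<approx> v"
  shows "set u = set v" "pairs u \<inter> adj M = pairs v \<inter> adj M"
  using braid_eq_invariants[OF matsumoto[OF assms]] by auto

end

section \<open>Parabolic subgroups as Coxeter groups\<close>

lemma coxeter_subset: "coxeter I M \<Longrightarrow> J \<subseteq> I \<Longrightarrow> coxeter J M"
  unfolding coxeter_def coxeter_matrix_def by (meson finite_subset subsetD)

lemma coxeter_eq_mono: "coxeter_eq J M u v \<Longrightarrow> J \<subseteq> I \<Longrightarrow> coxeter_eq I M u v"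
proof (induction rule: coxeter_eq.induct)
  case (trans u v w)
  then show ?case using coxeter_eq.trans by blast
qed (auto intro: coxeter_eq.refl coxeter_eq.sym coxeter_eq.append coxeter_eq.braid)

context coxeter
begin

lemma braid_eq_subset:
  "braid_eq u v \<Longrightarrow> set u \<subseteq> J \<Longrightarrow> J \<subseteq> I \<Longrightarrow> coxeter_eq J M u v"
proof (induction rule: braid_eq.induct)
  case (refl w)
  then show ?case by (auto intro: coxeter_eq.refl)
next
  case (trans u v w)
  then show ?case using braid_eq_invariants[OF trans.hyps(1)] coxeter_eq.trans by metis
next
  case (Cons u v x)
  then interpret J: coxeter J M using coxeter_subset[OF coxeter_axioms] by blast
  show ?case using Cons by (intro J.word_eq_Cons) auto
next
  case (braid a b m w)
  then interpret J: coxeter J M using coxeter_subset[OF coxeter_axioms] by blast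
  have "2 \<le> m" using M_ge_2[OF braid(1-3)] braid(4) by (simp add: numeral_eq_enat)
  then have "a \<in> J" "b \<in> J" using braid.prems set_alt[of m a b] by auto
  then show ?case using braid by (intro J.word_eq_append_right J.alt_braid) auto
qed

text \<open>Reducedness refers to all of \<open>I\<close>, whereas the equality uses relations of
  \<open>J\<close> only. Exchange is applied over \<open>I\<close>; Matsumoto's theorem carries its
  conclusion into \<open>J\<close>, because braid moves introduce no new letters.\<close>

lemma ex_reduced_subset:
  assumes "set u \<subseteq> J" "J \<subseteq> I"
  shows "\<exists>v. reduced v \<and> set v \<subseteq> J \<and> coxeter_eq J M u v"
proof -
  interpret J: coxeter J M using coxeter_subset[OF coxeter_axioms] assms by blast
  show ?thesis
    using assms(1)
  proof (induction u)
    case (Cons x u)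
    then obtain v where v: "reduced v" "set v \<subseteq> J" "coxeter_eq J M u v" by auto
    have xv: "coxeter_eq J M (x # u) (x # v)" using v Cons.prems by (intro J.word_eq_Cons) auto
    show ?case
    proof (cases "reduced (x # v)")
      case True
      then show ?thesis using v xv Cons.prems by (intro exI[of _ "x # v"]) auto
    next
      case False
      moreover have "x \<in> I" using Cons.prems assms(2) by auto
      ultimately obtain p y q where p: "v = p @ y # q" "[x] \<approx> p @ y # rev p"
        using exchange[OF v(1)] by blast
      have eq: "v \<approx> x # p @ q" using exchange_delete(2)[OF p(2), of q] p(1) reduced_set[OF v(1)] by simp
      have red: "reduced (x # p @ q)" using reduced_cong[OF v(1) eq] p(1) by simp
      have "coxeter_eq J M v (x # p @ q)"
        using braid_eq_subset[OF matsumoto[OF v(1) red eq] v(2) assms(2)] .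
      then have "coxeter_eq J M (x # v) (p @ q)" using J.Cons_word_eq_iff[of x v] Cons.prems by simp
      then have "coxeter_eq J M (x # u) (p @ q)" using xv coxeter_eq.trans by metis
      then show ?thesis using reduced_ConsD[OF red] J.word_eq_set(2) by blast
    qed
  qed (auto intro!: exI[of _ "[]"])
qed

text \<open>Injectivity of the natural map from the group of \<open>J\<close> to the group of
  \<open>I\<close>: reduce both words inside \<open>J\<close> and connect the reduced words by braid
  moves, which stay in \<open>J\<close>.\<close>

lemma coxeter_eq_subset:
  assumes "u \<approx> v" "set u \<subseteq> J" "set v \<subseteq> J" "J \<subseteq> I"
  shows "coxeter_eq J M u v"
proof -
  obtain u' where u': "reduced u'" "set u' \<subseteq> J" "coxeter_eq J M u u'"
    using ex_reduced_subset assms by blast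
  obtain v' where v': "reduced v'" "set v' \<subseteq> J" "coxeter_eq J M v v'"
    using ex_reduced_subset assms by blast
  have "u' \<approx> v'"
    using assms(1) coxeter_eq_mono[OF u'(3) assms(4)] coxeter_eq_mono[OF v'(3) assms(4)]
    by (meson word_eq_cong_left word_eq_cong_right)
  then have "coxeter_eq J M u' v'"
    using braid_eq_subset[OF matsumoto[OF u'(1) v'(1)] u'(2) assms(4)] by blast
  then show ?thesis using u'(3) v'(3) by (meson coxeter_eq.sym coxeter_eq.trans)
qed

lemma finite_type_subset:
  assumes "finite_type I M" "J \<subseteq> I"
  shows "finite_type J M"
proof -
  let ?f = "coxeter_class J M" and ?h = "coxeter_class I M"
  have "?f u = ?f v" if "u \<in> lists J" "v \<in> lists J" "?h u = ?h v" for u v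
  proof -
    have J: "set u \<subseteq> J" "set v \<subseteq> J" using that(1,2) by auto
    then have "u \<approx> v" using that(3) coxeter_class_eq_iff[of u I M v] assms(2) by fastforce
    then show ?thesis using coxeter_eq_subset[OF _ J assms(2)] coxeter_class_eq_iff[OF that(1)] by blast
  qed
  note f_eq = this
  \<comment> \<open>By \<open>f_eq\<close> the class over \<open>J\<close> is determined by the
    class over \<open>I\<close>: any word over \<open>J\<close> chosen from the latter gives it
    back.\<close>
  have "?f w \<in> (\<lambda>c. ?f (inv_into (lists J) ?h c)) ` ?h ` lists J" if w: "w \<in> lists J" for w
  proof -
    have "?h w \<in> ?h ` lists J" using w by (rule imageI)
    then have "?f w = ?f (inv_into (lists J) ?h (?h w))"
      by (intro f_eq w inv_into_into f_inv_into_f[symmetric])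
    then show ?thesis using w by blast
  qed
  then have "?f ` lists J \<subseteq> (\<lambda>c. ?f (inv_into (lists J) ?h c)) ` ?h ` lists J" by blast
  moreover have "finite (?h ` lists J)"
    using assms(1) image_mono[OF lists_mono[OF assms(2)], of ?h]
    by (simp add: finite_type_def coxeter_group_def finite_subset del: lists_eq_set)
  ultimately show ?thesis
    by (simp add: finite_type_def coxeter_group_def finite_subset del: lists_eq_set)
qed

end

section \<open>Longest elements and products over disjoint blocks\<close>


text \<open>The ordered adjacent pairs \<open>(a, b)\<close> such that the block of \<open>a\<close> is, or precedes, the block of \<open>b\<close>.\<close>

fun block_pairs :: "('i \<Rightarrow> 'i \<Rightarrow> enat) \<Rightarrow> 'i set list \<Rightarrow> ('i \<times> 'i) set" where
  "block_pairs M [] = {}"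
| "block_pairs M (J # Js) = J \<times> (J \<union> \<Union>(set Js)) \<inter> adj M \<union> block_pairs M Js"

definition block_lists :: "'i set \<Rightarrow> ('i \<Rightarrow> 'i \<Rightarrow> enat) \<Rightarrow> 'i set list set" where
  "block_lists I M = {Js. (\<forall>J\<in>set Js. connected_subset I M J) \<and> sorted_wrt disjnt Js}"

definition shape :: "('i \<Rightarrow> 'i \<Rightarrow> enat) \<Rightarrow> 'i set list \<Rightarrow> 'i set \<times> ('i \<times> 'i) set" where
  "shape M Js = (\<Union>(set Js), block_pairs M Js)"

definition shapes :: "nat \<Rightarrow> 'i set \<Rightarrow> ('i \<Rightarrow> 'i \<Rightarrow> enat) \<Rightarrow> ('i set \<times> ('i \<times> 'i) set) set" where
  "shapes k I M = shape M ` {Js \<in> block_lists I M. length Js = k}"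

lemma block_pairs_append:
  "block_pairs M (Js @ Ks)
    = block_pairs M Js \<union> (\<Union>(set Js) \<times> \<Union>(set Ks) \<inter> adj M) \<union> block_pairs M Ks"
  by (induction Js) auto

lemma block_pairs_subset: "block_pairs M Js \<subseteq> \<Union>(set Js) \<times> \<Union>(set Js) \<inter> adj M"
  by (induction Js) auto

lemma block_pairs_same_block:
  "J \<in> set Js \<Longrightarrow> J \<times> J \<inter> adj M \<subseteq> block_pairs M Js"
  by (induction Js) auto

lemma block_pairs_both:
  assumes "sorted_wrt disjnt Js" "J \<in> set Js" "a \<in> J" "(a, b) \<in> block_pairs M Js" "(b, a) \<in> block_pairs M Js"
  shows "b \<in> J"
  using assms
proof (induction Js)
  case (Cons K Js)
  have dis: "K \<inter> \<Union>(set Js) = {}" using Cons.prems(1) by (auto simp: disjnt_def)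
  have sub: "block_pairs M Js \<subseteq> \<Union>(set Js) \<times> \<Union>(set Js)" using block_pairs_subset[of M Js] by auto
  show ?case
  proof (cases "J = K")
    case True
    then show ?thesis using Cons.prems dis sub by auto
  next
    case False
    then have "J \<in> set Js" "a \<notin> K" using Cons.prems dis by auto
    then show ?thesis using Cons dis sub by auto
  qed
qed simp

lemma (in coxeter) doubleton_mem_coxeter_edges:
  assumes "J \<subseteq> I"
  shows "{x, y} \<in> coxeter_edges J M \<longleftrightarrow> (x, y) \<in> adj M \<inter> J \<times> J"
proof -
  have "{x, y} \<in> coxeter_edges J M \<longleftrightarrow> (\<exists>i j. {x, y} = {i, j} \<and> (i, j) \<in> adj M \<inter> J \<times> J)"
    by (auto simp: coxeter_edges_def adj_def)
  also have "\<dots> \<longleftrightarrow> (x, y) \<in> adj M \<inter> J \<times> J"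
    using adj_commute assms by (auto simp: doubleton_eq_iff)
  finally show ?thesis .
qed

lemma (in coxeter) connected_subset_iff:
  "connected_subset I M J \<longleftrightarrow> J \<subseteq> I \<and> J \<noteq> {} \<and> (\<forall>a\<in>J. \<forall>b\<in>J. (a, b) \<in> (adj M \<inter> J \<times> J)\<^sup>*)"
proof (cases "J \<subseteq> I")
  case True
  then have "{(x, y). {x, y} \<in> coxeter_edges J M} = adj M \<inter> J \<times> J"
    by (auto simp: doubleton_mem_coxeter_edges)
  then show ?thesis by (simp add: connected_subset_def)
qed (simp add: connected_subset_def)

context coxeter
begin

text \<open>The description of a longest element by its left descents. It makes the exchange
  condition applicable before existence and uniqueness of an element of maximal length are
  known.\<close>

definition full :: "'i set \<Rightarrow> 'i list \<Rightarrow> bool" where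
  "full J w \<longleftrightarrow> reduced w \<and> set w \<subseteq> J \<and> (\<forall>j\<in>J. \<not> reduced (j # w))"

text \<open>The letters of v are brought to the front from right to left. The next letter x shortens
  w = v r, and the letter deleted in exchange for x lies in r, because x v is reduced.\<close>

lemma full_prefix:
  assumes "full J w" "J \<subseteq> I" "reduced v" "set v \<subseteq> J"
  shows "\<exists>r. w \<approx> v @ r \<and> reduced (v @ r)"
  using assms(3,4)
proof (induction v)
  case Nil
  show ?case using assms by (intro exI[of _ w]) (auto simp: full_def)
next
  case (Cons x v)
  then obtain r where r: "w \<approx> v @ r" "reduced (v @ r)" using reduced_ConsD by fastforce
  have w: "reduced w" using assms(1) by (simp add: full_def)
  have x: "x \<in> I" using Cons.prems assms(2) by auto
  have "\<not> reduced (x # v @ r)"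
    using reduced_cong[OF _ coxeter_eq.sym[OF word_eq_Cons[OF r(1) x]]] reduced_length_eq[OF w r(2,1)]
      assms(1) Cons.prems by (auto simp: full_def)
  then obtain p y q where p: "v @ r = p @ y # q" "[x] \<approx> p @ y # rev p"
    using exchange[OF r(2) x] by blast
  have "\<exists>r1. p = v @ r1 \<and> r = r1 @ y # q"
  proof (rule ccontr)
    assume "\<not> ?thesis"
    then obtain q1 where q1: "v = p @ y # q1"
      using p(1) by (auto simp: append_eq_append_conv2 append_eq_Cons_conv)
    have "x # p @ y # q1 \<approx> p @ q1"
      using reduced_set[OF Cons.prems(1)] q1 by (intro exchange_delete(1) p(2)) auto
    then have "length (x # v) \<le> length (p @ q1)"
      using q1 by (intro reduced_le[OF Cons.prems(1)]) simp
    then show False using q1 by simp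
  qed
  then obtain r1 where r1: "p = v @ r1" "r = r1 @ y # q" by blast
  have "v @ r \<approx> x # p @ q"
    using exchange_delete(2)[OF p(2), of q] reduced_set[OF r(2)] p(1) by simp
  then have eq: "w \<approx> (x # v) @ r1 @ q" using r(1) r1 coxeter_eq.trans by fastforce
  moreover have "length ((x # v) @ r1 @ q) \<le> length w"
    using reduced_length_eq[OF w r(2,1)] r1 by simp
  ultimately show ?case using reduced_cong[OF w] by blast
qed

lemma class_eq_iff: "set u \<subseteq> I \<Longrightarrow> coxeter_class I M u = coxeter_class I M v \<longleftrightarrow> u \<approx> v"
  using coxeter_class_eq_iff[of u I M v] by auto

lemma parabolic_eq:
  assumes "J \<subseteq> I"
  shows "parabolic I M J = coxeter_class I M ` {w. set w \<subseteq> J}"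
proof
  interpret G: group "coxeter_group I M" using group_coxeter_group[OF coxeter_matrix] .
  have mult: "coxeter_class I M u \<otimes>\<^bsub>coxeter_group I M\<^esub> coxeter_class I M v = coxeter_class I M (u @ v)"
    if "set u \<subseteq> J" "set v \<subseteq> J" for u v
    using that assms by (intro coxeter_mult_class) auto
  have one: "\<one>\<^bsub>coxeter_group I M\<^esub> = coxeter_class I M []" by (simp add: coxeter_group_def)
  have car: "coxeter_class I M w \<in> carrier (coxeter_group I M)" if "set w \<subseteq> J" for w
    using that assms by (auto simp: coxeter_group_def)
  show "parabolic I M J \<subseteq> coxeter_class I M ` {w. set w \<subseteq> J}"
  proof
    fix x assume "x \<in> parabolic I M J"
    then show "x \<in> coxeter_class I M ` {w. set w \<subseteq> J}"
      unfolding parabolic_def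
    proof (induction rule: generate.induct)
      case one
      then show ?case by (auto simp: \<open>\<one>\<^bsub>coxeter_group I M\<^esub> = coxeter_class I M []\<close>)
    next
      case (incl h)
      then show ?case by (auto simp: simple_gen_def)
    next
      case (inv h)
      then obtain j where j: "j \<in> J" "h = coxeter_class I M [j]" by (auto simp: simple_gen_def)
      then have "[j, j] \<approx> []" using Cons_word_eq_iff[of j "[j]"] assms by auto
      then have "h \<otimes>\<^bsub>coxeter_group I M\<^esub> h = \<one>\<^bsub>coxeter_group I M\<^esub>"
        using j mult[of "[j]" "[j]"] one assms class_eq_iff[of "[j, j]" "[]"] by auto
      then have "inv\<^bsub>coxeter_group I M\<^esub> h = h" using G.inv_equality car[of "[j]"] j by simp
      then show ?case using j by auto
    next
      case (eng h1 h2)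
      then obtain u v where "set u \<subseteq> J" "set v \<subseteq> J" "h1 = coxeter_class I M u" "h2 = coxeter_class I M v"
        by auto
      then show ?case using mult by (intro image_eqI[of _ _ "u @ v"]) auto
    qed
  qed
  have "coxeter_class I M w \<in> parabolic I M J" if "set w \<subseteq> J" for w
    using that
  proof (induction w)
    case Nil
    then show ?case unfolding parabolic_def using generate.one[of "coxeter_group I M"] one by simp
  next
    case (Cons x w)
    then have "coxeter_class I M [x] \<in> parabolic I M J"
      by (auto simp: parabolic_def simple_gen_def intro!: generate.incl)
    then have "coxeter_class I M [x] \<otimes>\<^bsub>coxeter_group I M\<^esub> coxeter_class I M w \<in> parabolic I M J"
      using Cons unfolding parabolic_def by (intro generate.eng) auto
    then show ?case using mult[of "[x]" w] Cons.prems by simp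
  qed
  then show "coxeter_class I M ` {w. set w \<subseteq> J} \<subseteq> parabolic I M J" by blast
qed

lemma coxeter_length_class: "reduced w \<Longrightarrow> coxeter_length (coxeter_class I M w) = length w"
  unfolding coxeter_length_def coxeter_class_def
  by (intro Least_equality) (auto intro!: exI[of _ w] dest: reduced_le reduced_set)

lemma parabolicE:
  assumes "x \<in> parabolic I M J" "J \<subseteq> I"
  obtains w where "reduced w" "set w \<subseteq> J" "x = coxeter_class I M w"
proof -
  obtain u where u: "set u \<subseteq> J" "x = coxeter_class I M u" using assms by (auto simp: parabolic_eq)
  then obtain v where v: "reduced v" "set v \<subseteq> J" "coxeter_eq J M u v"
    using ex_reduced_subset assms(2) by blast
  then have "u \<approx> v" using coxeter_eq_mono assms(2) by blast
  then show ?thesis using that[of v] u v class_eq_iff[of u v] assms(2) by auto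
qed

text \<open>By \<open>full_prefix\<close> every v in the subgroup satisfies w = v r with lengths
  adding. Hence w has maximal length, and equality of lengths forces r to be empty, which is the
  uniqueness that \<open>THE\<close> demands.\<close>

lemma longest_eq:
  assumes "full J w" "J \<subseteq> I"
  shows "longest I M J = coxeter_class I M w"
  unfolding longest_def
proof (rule the_equality)
  have w: "reduced w" "set w \<subseteq> J" using assms by (auto simp: full_def)
  have in_par: "coxeter_class I M w \<in> parabolic I M J" using w assms by (auto simp: parabolic_eq)
  have len: "\<exists>r. w \<approx> v @ r \<and> length w = length v + length r" if "reduced v" "set v \<subseteq> J" for v
    using full_prefix[OF assms that] reduced_length_eq[OF w(1)] by fastforce
  have "coxeter_length x \<le> coxeter_length (coxeter_class I M w)" if x: "x \<in> parabolic I M J" for x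
  proof -
    obtain v where v: "reduced v" "set v \<subseteq> J" "x = coxeter_class I M v"
      using parabolicE[OF x assms(2)] .
    then show ?thesis using len[OF v(1,2)] w(1) by (auto simp: coxeter_length_class)
  qed
  then show "coxeter_class I M w \<in> parabolic I M J
    \<and> (\<forall>v\<in>parabolic I M J. coxeter_length v \<le> coxeter_length (coxeter_class I M w))"
    using in_par by blast
  fix x assume x: "x \<in> parabolic I M J
    \<and> (\<forall>v\<in>parabolic I M J. coxeter_length v \<le> coxeter_length x)"
  then obtain v where v: "reduced v" "set v \<subseteq> J" "x = coxeter_class I M v"
    using parabolicE[of x, OF _ assms(2)] by blast
  then have "length w \<le> length v" using x in_par w by (auto simp: coxeter_length_class)
  then have "w \<approx> v" using len[OF v(1,2)] by auto
  then show "x = coxeter_class I M w" using v class_eq_iff[of w v] word_eq_set by auto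
qed

lemma ex_full:
  assumes "finite_type I M" "J \<subseteq> I"
  shows "\<exists>w. full J w"
proof -
  let ?b = "Max (coxeter_length ` carrier (coxeter_group I M))"
  have bound: "length w \<le> ?b" if "reduced w" for w
  proof -
    have "coxeter_class I M w \<in> carrier (coxeter_group I M)"
      using reduced_set[OF that] by (auto simp: coxeter_group_def)
    then have "length w \<in> coxeter_length ` carrier (coxeter_group I M)"
      using coxeter_length_class[OF that] by (metis imageI)
    then show ?thesis
      using assms(1) by (simp add: finite_type_def)
  qed
  obtain w where w: "reduced w \<and> set w \<subseteq> J" "\<And>v. reduced v \<and> set v \<subseteq> J \<Longrightarrow> length v \<le> length w"
    using ex_has_greatest_nat[of "\<lambda>w. reduced w \<and> set w \<subseteq> J" "[]" length "Suc ?b"] bound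
    by (auto simp: less_Suc_eq_le)
  have "\<not> reduced (j # w)" if "j \<in> J" for j
    using w(2)[of "j # w"] w(1) that by auto
  then show ?thesis using w(1) by (auto simp: full_def)
qed

lemma reduced_singleton:
  assumes "j \<in> I"
  shows "reduced [j]"
proof -
  have "0 < length v" if "[j] \<approx> v" for v
    using word_eq_length_parity[OF that] by (intro odd_pos) simp
  then show ?thesis using assms by (auto simp: reduced_def Suc_le_eq)
qed

text \<open>If x were deleted against a letter of \<open>v\<close>, a conjugate of x over the
  letters of \<open>x # u\<close> would equal a reflection over the letters of \<open>v\<close>.
  Reduced words of the two have the same support, which must then be empty, although a reflection
  has odd length.\<close>

lemma reduced_append_disjoint:
  assumes "reduced u" "reduced v" "set u \<inter> set v = {}"
  shows "reduced (u @ v)"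
  using assms(1,3)
proof (induction u)
  case (Cons x u)
  have xI: "x \<in> I" "set u \<subseteq> I" using reduced_set[OF Cons.prems(1)] by auto
  have IH: "reduced (u @ v)" using Cons reduced_ConsD by auto
  show ?case
  proof (rule ccontr)
    assume "\<not> reduced ((x # u) @ v)"
    then obtain p y q where p: "u @ v = p @ y # q" "[x] \<approx> p @ y # rev p"
      using exchange[OF IH xI(1)] by auto
    have "\<exists>v1. p = u @ v1 \<and> v = v1 @ y # q"
    proof (rule ccontr)
      assume "\<not> ?thesis"
      then obtain q1 where q1: "u = p @ y # q1"
        using p(1) by (auto simp: append_eq_append_conv2 append_eq_Cons_conv)
      have "x # p @ y # q1 \<approx> p @ q1"
        using xI q1 by (intro exchange_delete(1) p(2)) auto
      then have "length (x # u) \<le> length (p @ q1)"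
        using q1 by (intro reduced_le[OF Cons.prems(1)]) simp
      then show False using q1 by simp
    qed
    then obtain v1 where v1: "p = u @ v1" "v = v1 @ y # q" by blast
    have "[x] @ u \<approx> u @ v1 @ y # rev v1"
      using p(2) v1 xI word_eq_append_iff[of u "[x]" "u @ v1 @ y # rev v1"] by simp
    then have eq: "rev u @ x # u \<approx> v1 @ y # rev v1"
      using xI append_word_eq_iff[of "rev u" "[x] @ u"] by simp
    obtain a where a: "reduced a" "set a \<subseteq> set (x # u)" "rev u @ x # u \<approx> a"
      using ex_reduced_subset[of "rev u @ x # u" "set (x # u)"] xI
        coxeter_eq_mono[of "set (x # u)" M _ _ I] by fastforce
    obtain b where b: "reduced b" "set b \<subseteq> set v" "v1 @ y # rev v1 \<approx> b"
      using ex_reduced_subset[of "v1 @ y # rev v1" "set v"] reduced_set[OF assms(2)] v1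
        coxeter_eq_mono[of "set v" M _ _ I] by fastforce
    have "a \<approx> b" using a(3) b(3) eq by (meson coxeter_eq.sym coxeter_eq.trans)
    then have "set a = set b" using reduced_invariants(1) a(1) b(1) by blast
    then have "set a \<subseteq> set (x # u) \<inter> set v" using a(2) b(2) by simp
    then have "set a = {}" unfolding Cons.prems(2) by simp
    then show False using word_eq_length_parity[OF a(3)] by simp
  qed
qed (use assms in simp)

lemma commute_words:
  assumes "set u \<subseteq> I" "set v \<subseteq> I" "\<And>a b. a \<in> set u \<Longrightarrow> b \<in> set v \<Longrightarrow> a \<noteq> b \<and> (a, b) \<notin> adj M"
  shows "u @ v \<approx> v @ u"
proof -
  have one: "a # v \<approx> v @ [a]" if "a \<in> I" "set v \<subseteq> I" "\<And>b. b \<in> set v \<Longrightarrow> a \<noteq> b \<and> (a, b) \<notin> adj M" for a v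
    using that
  proof (induction v)
    case (Cons b v)
    have "M a b = enat 2"
      using Cons.prems M_ge_2[of a b] by (force simp: adj_def numeral_eq_enat)
    then have "[a, b] \<approx> [b, a]" using alt_braid[of a b 2] Cons.prems by (simp add: numeral_2_eq_2)
    then have "[a, b] @ v \<approx> [b, a] @ v" using Cons.prems by (intro word_eq_append_right) auto
    moreover have "b # a # v \<approx> b # v @ [a]" using Cons by (intro word_eq_Cons) auto
    ultimately show ?case using coxeter_eq.trans by fastforce
  qed simp
  show ?thesis
    using assms(1,3)
  proof (induction u)
    case (Cons a u)
    have "a # u @ v \<approx> a # v @ u" using Cons by (intro word_eq_Cons) auto
    moreover have "(a # v) @ u \<approx> (v @ [a]) @ u"
      using Cons.prems assms(2) by (intro word_eq_append_right one) auto
    ultimately show ?case using coxeter_eq.trans by fastforce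
  qed (use assms in simp)
qed

end

text \<open>Transfers the count of group elements to a count of shapes: both sets are images of the
  block lists, under maps with the same fibres.\<close>

lemma card_image_cong:
  assumes "\<And>x y. x \<in> A \<Longrightarrow> y \<in> A \<Longrightarrow> f x = f y \<longleftrightarrow> g x = g y"
  shows "card (f ` A) = card (g ` A)"
proof (rule bij_betw_same_card)
  have g: "g (inv_into A f (f x)) = g x" if "x \<in> A" for x
    using assms[OF inv_into_into[OF imageI[OF that]] that] f_inv_into_f[OF imageI[OF that]] by blast
  have "inj_on (\<lambda>z. g (inv_into A f z)) (f ` A)"
    using g assms by (auto simp: inj_on_def)
  moreover have "(\<lambda>z. g (inv_into A f z)) ` f ` A = g ` A"
    unfolding image_image using g by (rule image_cong[OF HOL.refl])
  ultimately show "bij_betw (\<lambda>z. g (inv_into A f z)) (f ` A) (g ` A)"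
    by (simp add: bij_betw_def)
qed

locale coxeter_finite = coxeter I M for I :: "'i set" and M +
  assumes finite_type: "finite_type I M"
begin

definition longest_word :: "'i set \<Rightarrow> 'i list" where
  "longest_word J = (SOME w. full J w)"

lemma full_longest_word: "J \<subseteq> I \<Longrightarrow> full J (longest_word J)"
  unfolding longest_word_def using someI_ex[OF ex_full[OF finite_type]] .

text \<open>Up to equality in the group every reduced word over \<open>J\<close> is a prefix of the
  longest one. The prefixes j and ab yield the full support and both orders of each adjacent pair,
  since these data do not depend on the reduced word.\<close>

lemma longest_word:
  assumes "J \<subseteq> I"
  shows "reduced (longest_word J)" "set (longest_word J) = J"
    "pairs (longest_word J) \<inter> adj M = J \<times> J \<inter> adj M"
    "longest I M J = coxeter_class I M (longest_word J)"
proof -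
  note full = full_longest_word[OF assms]
  show red: "reduced (longest_word J)" using full by (simp add: full_def)
  show set: "set (longest_word J) = J"
  proof
    show "set (longest_word J) \<subseteq> J" using full by (simp add: full_def)
    show "J \<subseteq> set (longest_word J)"
    proof
      fix j assume j: "j \<in> J"
      then obtain r where "longest_word J \<approx> [j] @ r" "reduced ([j] @ r)"
        using full_prefix[OF full assms reduced_singleton[of j]] assms by auto
      then show "j \<in> set (longest_word J)" using reduced_invariants(1)[OF red] by fastforce
    qed
  qed
  have "(a, b) \<in> pairs (longest_word J)" if ab: "a \<in> J" "b \<in> J" "(a, b) \<in> adj M" for a b
  proof -
    have "reduced (alt 2 a b)"
      using ab assms by (intro reduced_alt) (auto simp: adj_def numeral_eq_enat)
    then have "reduced [a, b]" by (simp add: numeral_2_eq_2)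
    then obtain r where r: "longest_word J \<approx> [a, b] @ r" "reduced ([a, b] @ r)"
      using full_prefix[OF full assms, of "[a, b]"] ab by auto
    show ?thesis using reduced_invariants(2)[OF red r(2,1)] ab(3) by auto
  qed
  then show "pairs (longest_word J) \<inter> adj M = J \<times> J \<inter> adj M"
    using pairs_subset[of "longest_word J"] set by auto
  show "longest I M J = coxeter_class I M (longest_word J)" using longest_eq[OF full assms] .
qed

section \<open>Block words and their shapes\<close>

definition block_word :: "'i set list \<Rightarrow> 'i list" where
  "block_word Js = concat (map longest_word Js)"

lemma block_word_simps [simp]:
  "block_word [] = []" "block_word (J # Js) = longest_word J @ block_word Js"
  "block_word (Js @ Ks) = block_word Js @ block_word Ks"
  by (simp_all add: block_word_def)

lemma block_lists_Cons:
  "J # Js \<in> block_lists I M \<longleftrightarrow>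
    connected_subset I M J \<and> J \<inter> \<Union>(set Js) = {} \<and> Js \<in> block_lists I M"
  by (auto simp: block_lists_def disjnt_def)

lemma block_lists_subset: "Js \<in> block_lists I M \<Longrightarrow> J \<in> set Js \<Longrightarrow> J \<subseteq> I"
  by (auto simp: block_lists_def connected_subset_def)

lemma block_word:
  assumes "Js \<in> block_lists I M"
  shows "reduced (block_word Js)" "set (block_word Js) = \<Union>(set Js)"
    "pairs (block_word Js) \<inter> adj M = block_pairs M Js"
    "coxeter_prod I M (map (longest I M) Js) = coxeter_class I M (block_word Js)"
proof -
  have "reduced (block_word Js) \<and> set (block_word Js) = \<Union>(set Js)
    \<and> pairs (block_word Js) \<inter> adj M = block_pairs M Js
    \<and> coxeter_prod I M (map (longest I M) Js) = coxeter_class I M (block_word Js)"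
    using assms
  proof (induction Js)
    case Nil
    then show ?case by (simp add: coxeter_prod_def coxeter_group_def)
  next
    case (Cons J Js)
    then have J: "J \<subseteq> I" and dis: "J \<inter> \<Union>(set Js) = {}" and Js: "Js \<in> block_lists I M"
      by (auto simp: block_lists_Cons connected_subset_def)
    note IH = Cons.IH[OF Js] and J = J longest_word[OF J]
    have "reduced (longest_word J @ block_word Js)"
      using IH J dis by (intro reduced_append_disjoint) auto
    moreover have "pairs (longest_word J @ block_word Js) \<inter> adj M = block_pairs M (J # Js)"
      using IH J by (simp add: pairs_append Int_Un_distrib2) blast
    moreover have "coxeter_prod I M (map (longest I M) (J # Js)) = coxeter_class I M (longest_word J @ block_word Js)"
    proof -
      have "longest_word J \<in> lists I" "block_word Js \<in> lists I"
        using J(1,3) reduced_set[of "block_word Js"] IH by (auto simp del: UN_iff)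
      then show ?thesis
        using coxeter_mult_class[of "longest_word J" I "block_word Js" M] IH J(5) by (simp add: coxeter_prod_def)
    qed
    ultimately show ?case using IH J by simp
  qed
  then show "reduced (block_word Js)" "set (block_word Js) = \<Union>(set Js)"
    "pairs (block_word Js) \<inter> adj M = block_pairs M Js"
    "coxeter_prod I M (map (longest I M) Js) = coxeter_class I M (block_word Js)" by blast+
qed

lemma shape_eqI:
  assumes "Js \<in> block_lists I M" "Ks \<in> block_lists I M" "block_word Js \<approx> block_word Ks"
  shows "shape M Js = shape M Ks"
  using reduced_invariants[OF block_word(1)[OF assms(1)] block_word(1)[OF assms(2)] assms(3)]
  by (simp add: shape_def block_word(2,3) assms(1,2))

text \<open>Follow a path in \<open>J\<close> from the common point \<open>a\<close>. Each edge is
  recorded in both directions, which in \<open>Ks\<close> happens only inside one block, so the path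
  never leaves \<open>K\<close>.\<close>

lemma block_subset_block:
  assumes Js: "Js \<in> block_lists I M" and Ks: "Ks \<in> block_lists I M"
    and eq: "block_pairs M Js = block_pairs M Ks"
    and J: "J \<in> set Js" and K: "K \<in> set Ks" and a: "a \<in> J" "a \<in> K"
  shows "J \<subseteq> K"
proof
  fix b assume "b \<in> J"
  have J': "connected_subset I M J" using Js J by (simp add: block_lists_def)
  then have JI: "J \<subseteq> I" by (simp add: connected_subset_def)
  have "(a, b) \<in> (adj M \<inter> J \<times> J)\<^sup>*" using J' a \<open>b \<in> J\<close> by (auto simp: connected_subset_iff)
  then show "b \<in> K"
  proof (induction rule: rtrancl_induct)
    case (step b c)
    then have "(b, c) \<in> J \<times> J \<inter> adj M" "(c, b) \<in> J \<times> J \<inter> adj M"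
      using adj_commute[of b c] JI by auto
    then have "(b, c) \<in> block_pairs M Ks" "(c, b) \<in> block_pairs M Ks"
      using block_pairs_same_block[OF J, of M] eq by auto
    then show ?case using block_pairs_both[of Ks K b c M] Ks K step.IH by (auto simp: block_lists_def)
  qed (rule a)
qed

lemma block_lists_appendD:
  "Js @ J # Ks \<in> block_lists I M \<Longrightarrow> Js @ Ks \<in> block_lists I M"
  by (auto simp: block_lists_def sorted_wrt_append)

lemma block_lists_remove_pairs:
  assumes "Js @ J # Ks \<in> block_lists I M"
  shows "block_pairs M (Js @ Ks) = block_pairs M (Js @ J # Ks) - (J \<times> UNIV \<union> UNIV \<times> J)"
    "\<Union>(set (Js @ Ks)) = \<Union>(set (Js @ J # Ks)) - J"
proof -
  have dis: "J \<inter> (\<Union>(set Js) \<union> \<Union>(set Ks)) = {}"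
    using assms by (auto simp: block_lists_def sorted_wrt_append disjnt_def)
  then show "\<Union>(set (Js @ Ks)) = \<Union>(set (Js @ J # Ks)) - J" by auto
  show "block_pairs M (Js @ Ks) = block_pairs M (Js @ J # Ks) - (J \<times> UNIV \<union> UNIV \<times> J)"
    using dis block_pairs_subset[of M Js] block_pairs_subset[of M Ks]
    by (simp add: block_pairs_append) blast
qed

text \<open>The first block of one list occurs in the other and commutes with every block before it there.\<close>

lemma shape_eqD:
  "Js \<in> block_lists I M \<Longrightarrow> Ks \<in> block_lists I M \<Longrightarrow> shape M Js = shape M Ks
    \<Longrightarrow> block_word Js \<approx> block_word Ks \<and> length Js = length Ks"
proof (induction Js arbitrary: Ks)
  case Nil
  then have "K = {}" if "K \<in> set Ks" for K using that by (auto simp: shape_def)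
  moreover have "K \<noteq> {}" if "K \<in> set Ks" for K
    using that Nil.prems by (auto simp: block_lists_def connected_subset_def)
  ultimately have "Ks = []" by (cases Ks) auto
  then show ?case by simp
next
  case (Cons J Js)
  have eq: "block_pairs M (J # Js) = block_pairs M Ks" "\<Union>(set (J # Js)) = \<Union>(set Ks)"
    using Cons.prems(3) unfolding shape_def by blast+
  have J: "connected_subset I M J" "J \<inter> \<Union>(set Js) = {}" "Js \<in> block_lists I M"
    using Cons.prems(1) by (auto simp: block_lists_Cons)
  then have JI: "J \<subseteq> I" "J \<noteq> {}" by (auto simp: connected_subset_def)
  then obtain a where a: "a \<in> J" by auto
  moreover have "a \<in> \<Union>(set Ks)" using a eq(2)[symmetric] by simp
  ultimately obtain K where K: "K \<in> set Ks" "a \<in> K" by auto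
  have "J \<subseteq> K" using block_subset_block[OF Cons.prems(1,2) eq(1) _ K(1) a K(2)] by simp
  moreover have "K \<subseteq> J" using block_subset_block[OF Cons.prems(2,1) eq(1)[symmetric] K(1) _ K(2) a] by simp
  ultimately have "J \<in> set Ks" using K by auto
  then obtain P Q where PQ: "Ks = P @ J # Q" by (auto simp: in_set_conv_decomp)
  have blk: "P @ Q \<in> block_lists I M" using Cons.prems(2) block_lists_appendD PQ by blast
  have dis: "J \<inter> \<Union>(set P) = {}" "J \<inter> \<Union>(set Q) = {}"
    using Cons.prems(2) PQ by (auto simp: block_lists_def sorted_wrt_append disjnt_def)
  have PI: "\<Union>(set P) \<subseteq> I" using block_lists_subset[OF blk] by auto
  have P: "P \<in> block_lists I M" using blk by (auto simp: block_lists_def sorted_wrt_append)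
  \<comment> \<open>Deleting \<open>J\<close> and all pairs that meet it from the common data leaves
    equal data for the remaining blocks.\<close>
  have "shape M Js = shape M (P @ Q)"
    using block_lists_remove_pairs[of "[]" J Js] block_lists_remove_pairs[of P J Q]
      Cons.prems(1,2) eq PQ by (simp add: shape_def)
  then have IH: "block_word Js \<approx> block_word (P @ Q)" "length Js = length (P @ Q)"
    using Cons.IH[OF J(3) blk] by auto
  \<comment> \<open>An adjacent pair between \<open>J\<close> and a block of \<open>P\<close> would
    be recorded in both directions, since \<open>J\<close> comes first in one list and later in the
    other.\<close>
  have nadj: "(b, c) \<notin> adj M" if "b \<in> J" "c \<in> \<Union>(set P)" for b c
  proof
    assume "(b, c) \<in> adj M"
    then have cb: "(c, b) \<in> adj M" "(b, c) \<in> adj M" using adj_commute[of b c] that JI PI by auto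
    have "(c, b) \<in> block_pairs M Ks"
      using cb that PQ by (auto simp: block_pairs_append)
    moreover have "c \<in> \<Union>(set (J # Js))" unfolding eq(2) using that PQ by auto
    then have "(b, c) \<in> block_pairs M Ks" unfolding eq(1)[symmetric] using cb that by auto
    ultimately have "c \<in> J"
      using block_pairs_both[of Ks J b c M] Cons.prems(2) PQ that by (auto simp: block_lists_def)
    then show False using that dis by auto
  qed
  have "longest_word J @ block_word P \<approx> block_word P @ longest_word J"
  proof (rule commute_words)
    fix b c assume "b \<in> set (longest_word J)" "c \<in> set (block_word P)"
    then have "b \<in> J" "c \<in> \<Union>(set P)"
      by (simp_all only: block_word(2)[OF P] longest_word(2)[OF JI(1)])
    then show "b \<noteq> c \<and> (b, c) \<notin> adj M" using nadj dis(1) by blast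
  qed (simp_all only: block_word(2)[OF P] longest_word(2)[OF JI(1)] JI(1) PI)
  then have "block_word P @ longest_word J \<approx> longest_word J @ block_word P"
    by (rule coxeter_eq.sym)
  then have "(block_word P @ longest_word J) @ block_word Q \<approx> (longest_word J @ block_word P) @ block_word Q"
    using word_eq_set(2)[OF IH(1)] by (intro word_eq_append_right) auto
  moreover have "longest_word J @ block_word Js \<approx> longest_word J @ block_word (P @ Q)"
    using IH(1) longest_word(2)[OF JI(1)] JI by (intro word_eq_append_left) auto
  ultimately have "block_word (J # Js) \<approx> block_word Ks"
    using coxeter_eq.trans[OF _ coxeter_eq.sym] by (simp add: PQ)
  then show ?case using IH(2) PQ by simp
qed

lemma PP_eq: "PP k I M = (\<lambda>Js. coxeter_class I M (block_word Js)) ` {Js \<in> block_lists I M. length Js = k}"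
proof -
  have "PP k I M = (\<lambda>Js. coxeter_prod I M (map (longest I M) Js)) ` {Js \<in> block_lists I M. length Js = k}"
    by (auto simp: PP_def block_lists_def)
  also have "\<dots> = (\<lambda>Js. coxeter_class I M (block_word Js)) ` {Js \<in> block_lists I M. length Js = k}"
    by (rule image_cong) (auto simp: block_word(4))
  finally show ?thesis .
qed

lemma block_class_eq_iff:
  assumes "Js \<in> block_lists I M" "Ks \<in> block_lists I M"
  shows "coxeter_class I M (block_word Js) = coxeter_class I M (block_word Ks) \<longleftrightarrow> shape M Js = shape M Ks"
  using class_eq_iff[of "block_word Js" "block_word Ks"] shape_eqI[OF assms] shape_eqD[OF assms]
    reduced_set[OF block_word(1)[OF assms(1)]] by blast

lemma card_PP: "card (PP k I M) = card (shapes k I M)"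
  unfolding PP_eq shapes_def by (intro card_image_cong) (use block_class_eq_iff in auto)

lemma coeff_pp_shapes: "coeff (pp I M) k = int (card (shapes k I M))"
  by (simp add: coeff_pp finite_I card_PP)

text \<open>The shape determines the number of blocks, so each element has a well-defined k; this
  makes the value at 1 of the polynomial equal to the size of the union.\<close>

lemma PP_disjoint:
  assumes "k \<noteq> l"
  shows "PP k I M \<inter> PP l I M = {}"
proof -
  have "length Js = length Ks"
    if "Js \<in> block_lists I M" "Ks \<in> block_lists I M"
      "coxeter_class I M (block_word Js) = coxeter_class I M (block_word Ks)" for Js Ks
    using that(3) block_class_eq_iff[OF that(1,2)] shape_eqD[OF that(1,2)] by simp
  then show ?thesis using assms by (auto simp: PP_eq)
qed

lemma finite_PP: "finite (PP k I M)"
proof -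
  have "PP k I M \<subseteq> carrier (coxeter_group I M)"
    using reduced_set[OF block_word(1)] by (auto simp: PP_eq coxeter_group_def)
  then show ?thesis using finite_type finite_subset by (auto simp: finite_type_def)
qed

lemma card_PPs: "int (card (PPs I M)) = poly (pp I M) 1"
proof -
  have "PPs I M = (\<Union>k\<le>card I. PP k I M)"
    unfolding PPs_def using PP_empty[OF finite_I, of _ M] by (auto simp: Bex_def) (metis empty_iff not_less)
  then have "card (PPs I M) = (\<Sum>k\<le>card I. card (PP k I M))"
    using card_UN_disjoint[of "{..card I}" "\<lambda>k. PP k I M"] finite_PP PP_disjoint by simp
  then show ?thesis by (simp add: pp_def poly_sum poly_monom)
qed

end

section \<open>Removing a leaf of the Coxeter graph\<close>


lemma shapesE:
  assumes "s \<in> shapes k I M"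
  obtains Js where "Js \<in> block_lists I M" "length Js = k" "s = (\<Union>(set Js), block_pairs M Js)"
  using assms by (auto simp: shapes_def shape_def)

lemma block_lists_Union: "Js \<in> block_lists I M \<Longrightarrow> \<Union>(set Js) \<subseteq> I"
  by (auto simp: block_lists_def connected_subset_def)

lemma shapes_subset:
  assumes "(K, R) \<in> shapes k I M"
  shows "K \<subseteq> I" "R \<subseteq> K \<times> K"
proof -
  obtain Js where Js: "Js \<in> block_lists I M" "K = \<Union>(set Js)" "R = block_pairs M Js"
    using assms by (auto elim: shapesE)
  show "K \<subseteq> I" unfolding Js(2) by (rule block_lists_Union[OF Js(1)])
  show "R \<subseteq> K \<times> K" using block_pairs_subset[of M Js] unfolding Js(2,3) by simp
qed

lemma finite_shapes:
  assumes "finite I"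
  shows "finite (shapes k I M)"
proof (rule finite_subset)
  show "shapes k I M \<subseteq> Pow I \<times> Pow (I \<times> I)"
  proof
    fix s assume "s \<in> shapes k I M"
    then show "s \<in> Pow I \<times> Pow (I \<times> I)"
      using shapes_subset[of "fst s" "snd s" k I M] by (cases s) auto
  qed
qed (use assms in auto)

lemma connected_subset_mono:
  assumes "J \<subseteq> I"
  shows "connected_subset J M A \<longleftrightarrow> connected_subset I M A \<and> A \<subseteq> J"
  using assms by (auto simp: connected_subset_def)

lemma block_lists_mono:
  assumes "J \<subseteq> I"
  shows "Js \<in> block_lists J M \<longleftrightarrow> Js \<in> block_lists I M \<and> \<Union>(set Js) \<subseteq> J"
  unfolding block_lists_def mem_Collect_eq connected_subset_mono[OF assms, of M] Sup_le_iff by blast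

lemma shapes_mono:
  assumes "J \<subseteq> I"
  shows "shapes k J M = {s \<in> shapes k I M. fst s \<subseteq> J}"
  unfolding shapes_def block_lists_mono[OF assms] by (auto simp: shape_def)

lemma shapesI: "Js \<in> block_lists I M \<Longrightarrow> length Js = k \<Longrightarrow> shape M Js \<in> shapes k I M"
  by (auto simp: shapes_def)

lemma shapes_0: "shapes 0 I M = {({}, {})}"
  by (auto simp: shapes_def shape_def block_lists_def image_def)

context coxeter
begin

section \<open>Adding a vertex with at most one neighbour\<close>

context
  fixes x y :: 'i
  assumes x: "x \<in> I" and nbr: "\<And>z. z \<in> I \<Longrightarrow> (x, z) \<in> adj M \<Longrightarrow> z = y"
begin

lemma nbr': "z \<in> I \<Longrightarrow> (z, x) \<in> adj M \<Longrightarrow> z = y"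
  using nbr adj_commute x by blast

lemma not_adj_self: "(z, z) \<notin> adj M"
  by (simp add: adj_def)

text \<open>A path between points other than x can visit x only between two visits to y. Reading y
  in place of x gives a path that avoids x.\<close>

lemma connected_subset_remove_leaf:
  assumes A: "connected_subset I M A" "x \<in> A" "A \<noteq> {x}"
  shows "y \<in> A" "(x, y) \<in> adj M" "connected_subset I M (A - {x})"
proof -
  let ?r = "adj M \<inter> A \<times> A" and ?r' = "adj M \<inter> (A - {x}) \<times> (A - {x})"
  have AI: "A \<subseteq> I" and con: "\<And>a b. a \<in> A \<Longrightarrow> b \<in> A \<Longrightarrow> (a, b) \<in> ?r\<^sup>*"
    using A(1) by (auto simp: connected_subset_iff)
  obtain b where b: "b \<in> A" "b \<noteq> x" using A by auto
  then obtain z where "(x, z) \<in> ?r" using con[OF A(2) b(1)] by (metis converse_rtranclE)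
  then show yA: "y \<in> A" and xy: "(x, y) \<in> adj M" using nbr AI by auto
  have yx: "y \<noteq> x" using xy not_adj_self by auto
  have reach: "(a, c) \<in> ?r\<^sup>* \<Longrightarrow> (a, if c = x then y else c) \<in> ?r'\<^sup>*" if a: "a \<in> A - {x}" for a c
  proof (induction rule: rtrancl_induct)
    case (step c d)
    have cd: "c \<in> A" "d \<in> A" "(c, d) \<in> adj M" using step.hyps by auto
    consider "c = x" "d = y" | "d = x" "c = y" | "c \<noteq> x" "d \<noteq> x"
      using cd nbr nbr' AI by blast
    then show ?case
    proof cases
      case 3
      then have "(c, d) \<in> ?r'" using cd by auto
      then show ?thesis using step.IH 3 by (simp add: rtrancl.rtrancl_into_rtrancl)
    qed (use step.IH yx in auto)
  qed (use a in simp)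
  then have "(a, c) \<in> ?r'\<^sup>*" if "a \<in> A - {x}" "c \<in> A - {x}" for a c
    using reach[OF that(1) con[of a c]] that by simp
  then show "connected_subset I M (A - {x})"
    using AI b by (auto simp: connected_subset_iff)
qed

lemma connected_subset_insert_leaf:
  assumes A: "connected_subset I M A" "y \<in> A" and xy: "(x, y) \<in> adj M"
  shows "connected_subset I M (insert x A)"
proof -
  let ?r = "adj M \<inter> A \<times> A" and ?r' = "adj M \<inter> insert x A \<times> insert x A"
  have AI: "A \<subseteq> I" and con: "\<And>a b. a \<in> A \<Longrightarrow> b \<in> A \<Longrightarrow> (a, b) \<in> ?r\<^sup>*"
    using A(1) by (auto simp: connected_subset_iff)
  have "?r\<^sup>* \<subseteq> ?r'\<^sup>*" by (intro rtrancl_mono) auto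
  then have con': "(a, b) \<in> ?r'\<^sup>*" if "a \<in> A" "b \<in> A" for a b using con that by blast
  have "(x, y) \<in> ?r'" "(y, x) \<in> ?r'" using xy A(2) adj_commute[of x y] x AI by auto
  then have "(a, y) \<in> ?r'\<^sup>*" "(y, a) \<in> ?r'\<^sup>*" if "a \<in> insert x A" for a
    using that con' A(2) by auto
  then have "(a, b) \<in> ?r'\<^sup>*" if "a \<in> insert x A" "b \<in> insert x A" for a b
    using that rtrancl_trans by metis
  then show ?thesis unfolding connected_subset_iff using AI x by blast
qed

lemma shape_insert_leaf:
  assumes "Js @ A # Ks \<in> block_lists I M" "x \<notin> \<Union>(set (Js @ A # Ks))" "y \<in> A" "(x, y) \<in> adj M"
  shows "shape M (Js @ insert x A # Ks) =
    (insert x (fst (shape M (Js @ A # Ks))), snd (shape M (Js @ A # Ks)) \<union> {(x, y), (y, x)})"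
proof -
  have sub: "\<Union>(set Js) \<subseteq> I" "A \<subseteq> I" "\<Union>(set Ks) \<subseteq> I"
    using assms(1) by (auto simp: block_lists_def connected_subset_def)
  have y: "y \<notin> \<Union>(set Js)" "y \<notin> \<Union>(set Ks)"
    using assms(1,3) by (auto simp: block_lists_def sorted_wrt_append disjnt_def)
  have n: "(x, z) \<in> adj M \<longleftrightarrow> z = y" "(z, x) \<in> adj M \<longleftrightarrow> z = y" if "z \<in> I" for z
    using that nbr nbr' assms(4) adj_commute[of x y] x by blast+
  have "\<Union>(set Js) \<times> (insert x A \<union> \<Union>(set Ks)) \<inter> adj M = \<Union>(set Js) \<times> (A \<union> \<Union>(set Ks)) \<inter> adj M"
    using n(2) y(1) sub by auto
  moreover have "insert x A \<times> (insert x A \<union> \<Union>(set Ks)) \<inter> adj M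
      = A \<times> (A \<union> \<Union>(set Ks)) \<inter> adj M \<union> {(x, y), (y, x)}"
    using n y(2) sub assms(2,3) not_adj_self[of x] by auto
  ultimately show ?thesis
    by (simp add: shape_def block_pairs_append Un_ac)
qed

text \<open>The five parts: x outside the support; {x} a block without neighbour in the support; {x}
  a block before, or after, the block of y; x inside the block of y, where the number of blocks does
  not grow. Testing \<open>(x, y) \<in> adj M\<close> separately lets one decomposition serve both a
  leaf and an isolated vertex.\<close>

lemma shapes_leaf:
  shows "shapes (Suc k) I M = shapes (Suc k) (I - {x}) M
    \<union> (\<lambda>(K, R). (insert x K, R)) ` {s \<in> shapes k (I - {x}) M. \<not> (y \<in> fst s \<and> (x, y) \<in> adj M)}
    \<union> (\<lambda>(K, R). (insert x K, insert (x, y) R)) ` {s \<in> shapes k (I - {x}) M. y \<in> fst s \<and> (x, y) \<in> adj M}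
    \<union> (\<lambda>(K, R). (insert x K, insert (y, x) R)) ` {s \<in> shapes k (I - {x}) M. y \<in> fst s \<and> (x, y) \<in> adj M}
    \<union> (\<lambda>(K, R). (insert x K, R \<union> {(x, y), (y, x)})) ` {s \<in> shapes (Suc k) (I - {x}) M. y \<in> fst s \<and> (x, y) \<in> adj M}"
    (is "_ = ?A \<union> ?N \<union> ?L \<union> ?R \<union> ?B")
proof
  let ?J = "I - {x}"
  have J: "?J \<subseteq> I" by auto
  have n: "(x, z) \<in> adj M \<longleftrightarrow> z = y \<and> (x, y) \<in> adj M" "(z, x) \<in> adj M \<longleftrightarrow> z = y \<and> (x, y) \<in> adj M"
    if "z \<in> I" for z
    using that nbr nbr' adj_commute[of x z] x by blast+
  have row: "{x} \<times> U \<inter> adj M = (if y \<in> U \<and> (x, y) \<in> adj M then {(x, y)} else {})" if "U \<subseteq> I" for U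
    using n(1) that by (auto split: if_splits)
  have col: "U \<times> {x} \<inter> adj M = (if y \<in> U \<and> (x, y) \<in> adj M then {(y, x)} else {})" if "U \<subseteq> I" for U
    using n(2) that by (auto split: if_splits)
  have single: "connected_subset I M {x}" using x by (auto simp: connected_subset_iff)
  show "shapes (Suc k) I M \<subseteq> ?A \<union> ?N \<union> ?L \<union> ?R \<union> ?B"
  proof
    fix s assume "s \<in> shapes (Suc k) I M"
    then obtain Js where Js: "Js \<in> block_lists I M" "length Js = Suc k" "s = shape M Js"
      by (auto simp: shapes_def)
    show "s \<in> ?A \<union> ?N \<union> ?L \<union> ?R \<union> ?B"
    proof (cases "x \<in> \<Union>(set Js)")
      case False
      then have "Js \<in> block_lists ?J M"
        using Js(1) block_lists_mono[OF J] by (auto simp: block_lists_def connected_subset_def)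
      then show ?thesis using Js by (auto simp: shapes_def)
    next
      case True
      then obtain A P Q where A: "x \<in> A" and eq: "Js = P @ A # Q"
        by (auto simp: in_set_conv_decomp)
      have conA: "connected_subset I M A" and PQ: "P @ Q \<in> block_lists I M"
        and dis': "\<forall>B\<in>set P. disjnt B A" "\<forall>B\<in>set Q. disjnt A B" "\<forall>B\<in>set P. \<forall>C\<in>set Q. disjnt B C"
        using Js(1) eq by (simp_all add: block_lists_def sorted_wrt_append)
      have dis: "A \<inter> \<Union>(set P) = {}" "A \<inter> \<Union>(set Q) = {}" "\<Union>(set P) \<inter> \<Union>(set Q) = {}"
        subgoal using dis'(1) by (auto simp: disjnt_def)
        subgoal using dis'(2) by (auto simp: disjnt_def)
        subgoal using dis'(3) by (fastforce simp: disjnt_def)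
        done
      have sub: "\<Union>(set P) \<subseteq> I" "\<Union>(set Q) \<subseteq> I"
        using PQ by (auto simp: block_lists_def connected_subset_def)
      show ?thesis
      proof (cases "A = {x}")
        case True
        have "P @ Q \<in> block_lists ?J M"
          using PQ sub dis True by (subst block_lists_mono[OF J]) auto
        then have PQs: "shape M (P @ Q) \<in> shapes k ?J M"
          using Js(2) eq by (auto simp: shapes_def)
        have s: "s = (insert x (\<Union>(set (P @ Q))),
            block_pairs M (P @ Q) \<union> ({x} \<times> \<Union>(set Q) \<union> \<Union>(set P) \<times> {x}) \<inter> adj M)"
          using Js(3) eq True not_adj_self[of x] by (auto simp: shape_def block_pairs_append)
        consider "y \<in> \<Union>(set P)" "(x, y) \<in> adj M" | "y \<in> \<Union>(set Q)" "(x, y) \<in> adj M"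
          | "\<not> (y \<in> \<Union>(set (P @ Q)) \<and> (x, y) \<in> adj M)" by auto
        then show ?thesis
        proof cases
          case 1
          then have "({x} \<times> \<Union>(set Q) \<union> \<Union>(set P) \<times> {x}) \<inter> adj M = {(y, x)}"
            using dis(3) unfolding Int_Un_distrib2 row[OF sub(2)] col[OF sub(1)] by auto
          then have "s \<in> ?R"
            using s PQs 1 by (intro image_eqI[of _ _ "shape M (P @ Q)"]) (auto simp: shape_def)
          then show ?thesis by blast
        next
          case 2
          then have "({x} \<times> \<Union>(set Q) \<union> \<Union>(set P) \<times> {x}) \<inter> adj M = {(x, y)}"
            using dis(3) unfolding Int_Un_distrib2 row[OF sub(2)] col[OF sub(1)] by auto
          then have "s \<in> ?L"
            using s PQs 2 by (intro image_eqI[of _ _ "shape M (P @ Q)"]) (auto simp: shape_def)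
          then show ?thesis by blast
        next
          case 3
          then have "({x} \<times> \<Union>(set Q) \<union> \<Union>(set P) \<times> {x}) \<inter> adj M = {}"
            unfolding Int_Un_distrib2 row[OF sub(2)] col[OF sub(1)] by auto
          then have "s \<in> ?N"
            using s PQs 3 by (intro image_eqI[of _ _ "shape M (P @ Q)"]) (auto simp: shape_def)
          then show ?thesis by blast
        qed
      next
        case False
        let ?K = "P @ (A - {x}) # Q"
        note leaf = connected_subset_remove_leaf[OF conA A False]
        have yx: "y \<noteq> x" using leaf(2) not_adj_self by auto
        have K: "?K \<in> block_lists I M"
          using Js(1) eq leaf(3) by (auto simp: block_lists_def sorted_wrt_append disjnt_def)
        moreover have xK: "x \<notin> \<Union>(set ?K)" using dis A by auto
        moreover have "\<Union>(set ?K) \<subseteq> I" using sub conA by (auto simp: connected_subset_def)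
        ultimately have "?K \<in> block_lists ?J M" by (subst block_lists_mono[OF J]) auto
        then have Ks: "shape M ?K \<in> shapes (Suc k) ?J M"
          using Js(2) eq by (auto simp: shapes_def)
        have "insert x (A - {x}) = A" using A by auto
        then have "s = (insert x (fst (shape M ?K)), snd (shape M ?K) \<union> {(x, y), (y, x)})"
          using shape_insert_leaf[OF K xK _ leaf(2)] leaf(1) yx Js(3) eq by simp
        moreover have "y \<in> fst (shape M ?K)" using leaf(1) yx by (auto simp: shape_def)
        ultimately have "s \<in> ?B"
          using Ks leaf(2) by (intro image_eqI[of _ _ "shape M ?K"]) (auto simp: split_beta)
        then show ?thesis by blast
      qed
    qed
  qed
  have ext: "Js \<in> block_lists I M \<and> \<Union>(set Js) \<subseteq> ?J" if "Js \<in> block_lists ?J M" for Js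
    using that block_lists_mono[OF J] by blast
  \<comment> \<open>The block {x} interacts only with the block of y, so every shape containing it
    already arises with {x} at an end of the list: in front for \<open>?N\<close> and
    \<open>?L\<close>, at the rear for \<open>?R\<close>.\<close>
  have front: "shape M ({x} # Js) \<in> shapes (Suc k) I M"
    "shape M ({x} # Js) = (insert x (\<Union>(set Js)), {x} \<times> \<Union>(set Js) \<inter> adj M \<union> block_pairs M Js)"
    if "Js \<in> block_lists ?J M" "length Js = k" for Js
  proof -
    have "{x} # Js \<in> block_lists I M"
      using ext[OF that(1)] single by (auto simp: block_lists_def disjnt_def)
    then show "shape M ({x} # Js) \<in> shapes (Suc k) I M" using that(2) by (intro shapesI) auto
    show "shape M ({x} # Js) = (insert x (\<Union>(set Js)), {x} \<times> \<Union>(set Js) \<inter> adj M \<union> block_pairs M Js)"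
      using not_adj_self[of x] by (auto simp: shape_def)
  qed
  have rear: "shape M (Js @ [{x}]) \<in> shapes (Suc k) I M"
    "shape M (Js @ [{x}]) = (insert x (\<Union>(set Js)), \<Union>(set Js) \<times> {x} \<inter> adj M \<union> block_pairs M Js)"
    if "Js \<in> block_lists ?J M" "length Js = k" for Js
  proof -
    have "Js @ [{x}] \<in> block_lists I M"
      using ext[OF that(1)] single by (auto simp: block_lists_def disjnt_def sorted_wrt_append)
    then show "shape M (Js @ [{x}]) \<in> shapes (Suc k) I M" using that(2) by (intro shapesI) auto
    show "shape M (Js @ [{x}]) = (insert x (\<Union>(set Js)), \<Union>(set Js) \<times> {x} \<inter> adj M \<union> block_pairs M Js)"
      using not_adj_self[of x] by (auto simp: shape_def block_pairs_append)
  qed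
  show "?A \<union> ?N \<union> ?L \<union> ?R \<union> ?B \<subseteq> shapes (Suc k) I M"
  proof (intro Un_least subsetI)
    fix s assume "s \<in> ?A"
    then show "s \<in> shapes (Suc k) I M" using shapes_mono[OF J, of "Suc k" M] by blast
  next
    fix s assume "s \<in> ?N"
    then obtain Js where Js: "Js \<in> block_lists ?J M" "length Js = k" "\<not> (y \<in> \<Union>(set Js) \<and> (x, y) \<in> adj M)"
      "s = (insert x (\<Union>(set Js)), block_pairs M Js)" by (auto simp: shapes_def shape_def)
    moreover have "{x} \<times> \<Union>(set Js) \<inter> adj M = {}" using Js(3) ext[OF Js(1)] by (subst row) auto
    ultimately show "s \<in> shapes (Suc k) I M" using front[OF Js(1,2)] by simp
  next
    fix s assume "s \<in> ?L"
    then obtain Js where Js: "Js \<in> block_lists ?J M" "length Js = k" "y \<in> \<Union>(set Js)" "(x, y) \<in> adj M"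
      "s = (insert x (\<Union>(set Js)), insert (x, y) (block_pairs M Js))" by (auto simp: shapes_def shape_def)
    moreover have "{x} \<times> \<Union>(set Js) \<inter> adj M = {(x, y)}" using Js(3,4) ext[OF Js(1)] by (subst row) auto
    ultimately show "s \<in> shapes (Suc k) I M" using front[OF Js(1,2)] by simp
  next
    fix s assume "s \<in> ?R"
    then obtain Js where Js: "Js \<in> block_lists ?J M" "length Js = k" "y \<in> \<Union>(set Js)" "(x, y) \<in> adj M"
      "s = (insert x (\<Union>(set Js)), insert (y, x) (block_pairs M Js))" by (auto simp: shapes_def shape_def)
    moreover have "\<Union>(set Js) \<times> {x} \<inter> adj M = {(y, x)}" using Js(3,4) ext[OF Js(1)] by (subst col) auto
    ultimately show "s \<in> shapes (Suc k) I M" using rear[OF Js(1,2)] by simp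
  next
    fix s assume "s \<in> ?B"
    then obtain Js where Js: "Js \<in> block_lists ?J M" "length Js = Suc k" "y \<in> \<Union>(set Js)" and xy: "(x, y) \<in> adj M"
      and s: "s = (insert x (fst (shape M Js)), snd (shape M Js) \<union> {(x, y), (y, x)})"
      by (auto simp: shapes_def shape_def)
    then obtain A P Q where A: "y \<in> A" and eq: "Js = P @ A # Q"
      by (auto simp: in_set_conv_decomp)
    have blk: "P @ A # Q \<in> block_lists I M" "x \<notin> \<Union>(set (P @ A # Q))"
      using ext[OF Js(1)] eq by auto
    have "connected_subset I M (insert x A)"
      using connected_subset_insert_leaf[of A] A xy blk(1) by (auto simp: block_lists_def)
    then have "P @ insert x A # Q \<in> block_lists I M"
      using blk by (auto simp: block_lists_def sorted_wrt_append disjnt_def)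
    moreover have "s = shape M (P @ insert x A # Q)"
      using shape_insert_leaf[OF blk A xy] s eq by simp
    ultimately show "s \<in> shapes (Suc k) I M"
      using Js(2) eq by (auto intro: shapesI)
  qed
qed

lemma card_shapes_split:
  "card (shapes (Suc k) I M) = card (shapes (Suc k) (I - {x}) M)
    + card {s \<in> shapes k (I - {x}) M. \<not> (y \<in> fst s \<and> (x, y) \<in> adj M)}
    + 2 * card {s \<in> shapes k (I - {x}) M. y \<in> fst s \<and> (x, y) \<in> adj M}
    + card {s \<in> shapes (Suc k) (I - {x}) M. y \<in> fst s \<and> (x, y) \<in> adj M}"
proof -
  let ?J = "I - {x}"
  define A where "A k = shapes k ?J M" for k
  define N where "N k = {s \<in> A k. \<not> (y \<in> fst s \<and> (x, y) \<in> adj M)}" for k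
  define Y where "Y k = {s \<in> A k. y \<in> fst s \<and> (x, y) \<in> adj M}" for k
  have yx: "y \<noteq> x" if "(x, y) \<in> adj M" using that not_adj_self by auto
  have finA: "finite (A k)" for k unfolding A_def using finite_I by (intro finite_shapes) auto
  then have fin: "finite (N k)" "finite (Y k)" for k by (simp_all add: N_def Y_def)
  have xs: "x \<notin> K" "(x, z) \<notin> R" "(z, x) \<notin> R" if "(K, R) \<in> A k" for K R k z
    using shapes_subset[OF that[unfolded A_def]] by auto
  define fN fL fR fB where "fN = (\<lambda>(K, R). (insert x K, R :: ('i \<times> 'i) set))"
    and "fL = (\<lambda>(K, R). (insert x K, insert (x, y) R))"
    and "fR = (\<lambda>(K, R). (insert x K, insert (y, x) R))"
    and "fB = (\<lambda>(K, R). (insert x K, R \<union> {(x, y), (y, x)}))"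
  note f_defs = fN_def fL_def fR_def fB_def
  have "shapes (Suc k) I M = A (Suc k) \<union> fN ` N k \<union> fL ` Y k \<union> fR ` Y k \<union> fB ` Y (Suc k)"
    unfolding f_defs A_def N_def Y_def by (rule shapes_leaf)
  note eq = this
  have sub: "x \<notin> K \<and> (\<forall>(a, b)\<in>R. a \<in> ?J \<and> b \<in> ?J)" if "(K, R) \<in> A k" for K R k
    using shapes_subset[OF that[unfolded A_def]] by auto
  \<comment> \<open>All four maps have the same left inverse, which removes x from the support
    together with every pair containing x.\<close>
  have inj: "inj_on fN (N k)" "inj_on fL (Y k)" "inj_on fR (Y k)" "inj_on fB (Y (Suc k))"
    by (rule inj_on_inverseI[where g = "\<lambda>(K, R). (K - {x}, R \<inter> ?J \<times> ?J)"];
        auto simp: f_defs N_def Y_def dest!: sub)+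
  have mark0: "x \<notin> fst s" if "s \<in> A (Suc k)" for s
    using that xs by (cases s) auto
  \<comment> \<open>The images are told apart by which of (x, y) and (y, x) are present; the
    presence of x separates them from \<open>A (Suc k)\<close>.\<close>
  have mark: "s \<in> fN ` N k \<Longrightarrow> x \<in> fst s \<and> (x, y) \<notin> snd s \<and> (y, x) \<notin> snd s"
    "s \<in> fL ` Y k \<Longrightarrow> x \<in> fst s \<and> (x, y) \<in> snd s \<and> (y, x) \<notin> snd s"
    "s \<in> fR ` Y k \<Longrightarrow> x \<in> fst s \<and> (x, y) \<notin> snd s \<and> (y, x) \<in> snd s"
    "s \<in> fB ` Y (Suc k) \<Longrightarrow> x \<in> fst s \<and> (x, y) \<in> snd s \<and> (y, x) \<in> snd s" for s
    using yx by (auto simp: f_defs N_def Y_def dest: xs)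
  have "A (Suc k) \<inter> fN ` N k = {}"
    using mark0 mark(1) by (meson disjoint_iff)
  moreover have "(A (Suc k) \<union> fN ` N k) \<inter> fL ` Y k = {}"
    unfolding disjoint_iff
  proof (intro allI impI)
    fix s assume "s \<in> A (Suc k) \<union> fN ` N k"
    then show "s \<notin> fL ` Y k"
      using mark0[of s] mark(1)[of s] mark(2)[of s] unfolding Un_iff by argo
  qed
  moreover have "(A (Suc k) \<union> fN ` N k \<union> fL ` Y k) \<inter> fR ` Y k = {}"
    unfolding disjoint_iff
  proof (intro allI impI)
    fix s assume "s \<in> A (Suc k) \<union> fN ` N k \<union> fL ` Y k"
    then show "s \<notin> fR ` Y k"
      using mark0[of s] mark(1)[of s] mark(2)[of s] mark(3)[of s] unfolding Un_iff by argo
  qed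
  moreover have "(A (Suc k) \<union> fN ` N k \<union> fL ` Y k \<union> fR ` Y k) \<inter> fB ` Y (Suc k) = {}"
    unfolding disjoint_iff
  proof (intro allI impI)
    fix s assume "s \<in> A (Suc k) \<union> fN ` N k \<union> fL ` Y k \<union> fR ` Y k"
    then show "s \<notin> fB ` Y (Suc k)"
      using mark0[of s] mark[of s] unfolding Un_iff by argo
  qed
  ultimately have "card (shapes (Suc k) I M) = card (A (Suc k)) + card (N k) + 2 * card (Y k) + card (Y (Suc k))"
    unfolding eq using fin finA inj by (simp add: card_Un_disjoint card_image)
  then show ?thesis by (simp add: A_def N_def Y_def)
qed

text \<open>The shapes over \<open>I - {x}\<close> with y in the support are all of them minus those
  over \<open>I - {x, y}\<close>. With this difference inserted, the count becomes the same
  expression at \<open>Suc k\<close> and at \<open>k\<close>, as the factor 1 + t requires.\<close>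

lemma card_shapes_leaf:
  assumes "(x, y) \<in> adj M" "y \<in> I"
  shows "int (card (shapes (Suc k) I M)) =
    2 * int (card (shapes (Suc k) (I - {x}) M)) - int (card (shapes (Suc k) (I - {x, y}) M))
    + (2 * int (card (shapes k (I - {x}) M)) - int (card (shapes k (I - {x, y}) M)))"
proof -
  have "card (shapes k (I - {x}) M) = card (shapes k (I - {x, y}) M)
      + card {s \<in> shapes k (I - {x}) M. y \<in> fst s}" for k
  proof -
    have N: "shapes k (I - {x, y}) M = {s \<in> shapes k (I - {x}) M. y \<notin> fst s}"
      using shapes_mono[of "I - {x, y}" "I - {x}" k M] shapes_subset(1)[of _ _ k "I - {x}" M]
      by fastforce
    have "card ({s \<in> shapes k (I - {x}) M. y \<notin> fst s} \<union> {s \<in> shapes k (I - {x}) M. y \<in> fst s})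
        = card {s \<in> shapes k (I - {x}) M. y \<notin> fst s} + card {s \<in> shapes k (I - {x}) M. y \<in> fst s}"
      using finite_shapes[of "I - {x}" k M] finite_I by (intro card_Un_disjoint) auto
    moreover have "{s \<in> shapes k (I - {x}) M. y \<notin> fst s} \<union> {s \<in> shapes k (I - {x}) M. y \<in> fst s}
        = shapes k (I - {x}) M" by auto
    ultimately show ?thesis by (simp only: N)
  qed
  moreover have "{s \<in> shapes k (I - {x}) M. y \<notin> fst s} = shapes k (I - {x, y}) M"
    using shapes_mono[of "I - {x, y}" "I - {x}" k M] shapes_subset(1)[of _ _ k "I - {x}" M]
    by fastforce
  ultimately show ?thesis using assms by (simp add: card_shapes_split)
qed

lemma card_shapes_isolated:
  assumes "(x, y) \<notin> adj M"
  shows "card (shapes (Suc k) I M) = card (shapes (Suc k) (I - {x}) M) + card (shapes k (I - {x}) M)"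
  using assms by (simp add: card_shapes_split)

end

end


section \<open>Recurrences for the polynomials and their values at 1\<close>

context coxeter_finite
begin

lemma coxeter_finite_subset: "J \<subseteq> I \<Longrightarrow> coxeter_finite J M"
  unfolding coxeter_finite_def coxeter_finite_axioms_def
  using coxeter_subset[OF coxeter_axioms] finite_type_subset[OF finite_type] by blast

lemma coeff_pp_subset: "J \<subseteq> I \<Longrightarrow> coeff (pp J M) k = int (card (shapes k J M))"
  using coxeter_finite.coeff_pp_shapes[OF coxeter_finite_subset] .

lemma pp_leaf:
  assumes "J \<subseteq> I" "x \<in> J" "y \<in> J" "(x, y) \<in> adj M" "\<And>z. z \<in> J \<Longrightarrow> (x, z) \<in> adj M \<Longrightarrow> z = y"
  shows "pp J M = [:1, 1:] * (2 * pp (J - {x}) M - pp (J - {x, y}) M)"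
proof (rule poly_eqI)
  fix k
  interpret J: coxeter J M using coxeter_subset[OF coxeter_axioms assms(1)] .
  have c: "coeff (pp (J - A) M) k = int (card (shapes k (J - A) M))" for A k
    using assms(1) by (intro coeff_pp_subset) auto
  have two: "2 * p = smult 2 p" for p :: "int poly"
    by (simp add: numeral_poly)
  show "coeff (pp J M) k = coeff ([:1, 1:] * (2 * pp (J - {x}) M - pp (J - {x, y}) M)) k"
  proof (cases k)
    case 0
    then show ?thesis using coeff_pp_subset[OF assms(1)] c by (simp add: two shapes_0)
  next
    case (Suc k)
    then show ?thesis
      using coeff_pp_subset[OF assms(1)] c J.card_shapes_leaf[OF assms(2,5,4,3)]
      by (simp add: two)
  qed
qed

lemma pp_isolated:
  assumes "J \<subseteq> I" "x \<in> J" "\<And>z. z \<in> J \<Longrightarrow> (x, z) \<notin> adj M"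
  shows "pp J M = [:1, 1:] * pp (J - {x}) M"
proof (rule poly_eqI)
  fix k
  interpret J: coxeter J M using coxeter_subset[OF coxeter_axioms assms(1)] .
  have c: "coeff (pp (J - A) M) k = int (card (shapes k (J - A) M))" for A k
    using assms(1) by (intro coeff_pp_subset) auto
  show "coeff (pp J M) k = coeff ([:1, 1:] * pp (J - {x}) M) k"
  proof (cases k)
    case 0
    then show ?thesis using coeff_pp_subset[OF assms(1)] c by (simp add: shapes_0)
  next
    case (Suc k)
    then show ?thesis
      using coeff_pp_subset[OF assms(1)] c J.card_shapes_isolated[OF assms(2), of x k] assms(2,3)
      by auto
  qed
qed

definition num_pp :: "'i set \<Rightarrow> int" where
  "num_pp J = poly (pp J M) 1"

lemma num_pp_leaf:
  assumes "J \<subseteq> I" "x \<in> J" "y \<in> J" "(x, y) \<in> adj M" "\<And>z. z \<in> J \<Longrightarrow> (x, z) \<in> adj M \<Longrightarrow> z = y"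
  shows "num_pp J = 4 * num_pp (J - {x}) - 2 * num_pp (J - {x, y})"
proof -
  have "pp J M = [:1, 1:] * (2 * pp (J - {x}) M - pp (J - {x, y}) M)"
    using pp_leaf[OF assms(1-4)] assms(5) by blast
  then show ?thesis by (simp add: num_pp_def)
qed

lemma num_pp_isolated:
  assumes "J \<subseteq> I" "x \<in> J" "\<And>z. z \<in> J \<Longrightarrow> (x, z) \<notin> adj M"
  shows "num_pp J = 2 * num_pp (J - {x})"
proof -
  have "pp J M = [:1, 1:] * pp (J - {x}) M"
  proof (rule pp_isolated)
    fix z assume "z \<in> J"
    then show "(x, z) \<notin> adj M" by (rule assms(3))
  qed (fact assms)+
  then show ?thesis by (simp add: num_pp_def)
qed

end

lemma pp_empty: "pp {} M = 1"
  by (simp add: pp_def PP_0)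

section \<open>The numerical sequences\<close>


lemma sum_even_odd:
  "(\<Sum>j\<le>n. f j) = (\<Sum>k\<le>n div 2. f (2 * k)) + (\<Sum>k<(n + 1) div 2. f (2 * k + 1))"
  for f :: "nat \<Rightarrow> real"
proof (induction n)
  case (Suc n)
  show ?case
  proof (cases "even n")
    case True
    then obtain m where "n = 2 * m" by auto
    then show ?thesis using Suc by (simp add: add.assoc)
  next
    case False
    then obtain m where "n = 2 * m + 1" by (metis oddE)
    then show ?thesis using Suc by (simp add: add_ac)
  qed
qed simp

lemma sqrt2_even_power:
  assumes "2 * k \<le> n"
  shows "sqrt 2 ^ (2 * k) * 2 ^ (n - 2 * k) = (2 :: real) ^ (n - k)"
proof -
  have "n - k = k + (n - 2 * k)" using assms by linarith
  then have "(2 :: real) ^ (n - k) = 2 ^ k * 2 ^ (n - 2 * k)" by (simp only: power_add)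
  then show ?thesis by (simp add: power_mult)
qed

text \<open>The sum is the even part of the binomial expansion of (2 + sqrt 2)^n; averaging with the
  conjugate power removes the odd part.\<close>

lemma a_seq_closed_form: "real (a_seq n) = ((2 + sqrt 2) ^ n + (2 - sqrt 2) ^ n) / 2"
proof -
  define f where "f j = real (n choose j) * (sqrt 2 ^ j + (- sqrt 2) ^ j) * 2 ^ (n - j)" for j
  have "(2 + sqrt 2) ^ n + (2 - sqrt 2) ^ n = (\<Sum>j\<le>n. f j)"
    using binomial_ring[of "sqrt 2" 2 n] binomial_ring[of "- sqrt 2" 2 n]
    by (simp add: f_def sum.distrib[symmetric] algebra_simps)
  also have "\<dots> = (\<Sum>k\<le>n div 2. f (2 * k)) + (\<Sum>k<(n + 1) div 2. f (2 * k + 1))"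
    by (rule sum_even_odd)
  also have "(\<Sum>k<(n + 1) div 2. f (2 * k + 1)) = 0"
    by (rule sum.neutral) (simp add: f_def)
  also have "(\<Sum>k\<le>n div 2. f (2 * k)) = (\<Sum>k\<le>n div 2. 2 * (real (n choose (2 * k)) * 2 ^ (n - k)))"
  proof (rule sum.cong)
    fix k assume "k \<in> {..n div 2}"
    then have "2 * k \<le> n" by auto
    from sqrt2_even_power[OF this, symmetric]
    show "f (2 * k) = 2 * (real (n choose (2 * k)) * 2 ^ (n - k))" by (simp add: f_def)
  qed simp
  finally show ?thesis by (simp add: a_seq_def sum_distrib_left[symmetric])
qed

text \<open>Up to a factor sqrt 2 the sum in \<open>d_seq\<close> is the odd part of the same
  expansion. The shift to n + 2 turns the upper index n - 2 into n and contributes the factor 2^2 =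
  4.\<close>

lemma d_seq_closed_form:
  "real (d_seq (n + 2)) = (2 + sqrt 2) ^ (n + 1) + (2 - sqrt 2) ^ (n + 1)
    + 4 * (((2 + sqrt 2) ^ n - (2 - sqrt 2) ^ n) / sqrt 2)"
proof -
  define f where "f j = real (n choose j) * (sqrt 2 ^ j - (- sqrt 2) ^ j) * 2 ^ (n - j)" for j
  let ?s = "\<Sum>k<(n + 1) div 2. (n choose (2 * k + 1)) * 2 ^ (n - k)"
  have "(2 + sqrt 2) ^ n - (2 - sqrt 2) ^ n = (\<Sum>j\<le>n. f j)"
    using binomial_ring[of "sqrt 2" 2 n] binomial_ring[of "- sqrt 2" 2 n]
    by (simp add: f_def sum_subtractf[symmetric] algebra_simps)
  also have "\<dots> = (\<Sum>k\<le>n div 2. f (2 * k)) + (\<Sum>k<(n + 1) div 2. f (2 * k + 1))"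
    by (rule sum_even_odd)
  also have "(\<Sum>k\<le>n div 2. f (2 * k)) = 0"
    by (rule sum.neutral) (simp add: f_def)
  also have "(\<Sum>k<(n + 1) div 2. f (2 * k + 1))
      = (\<Sum>k<(n + 1) div 2. sqrt 2 * (real (n choose (2 * k + 1)) * 2 ^ (n - k)))"
  proof (rule sum.cong)
    fix k assume "k \<in> {..<(n + 1) div 2}"
    then have k: "2 * k \<le> n - 1" "0 < n" "k \<le> n - 1" by auto
    have n: "n - (2 * k + 1) = n - 1 - 2 * k" "n - k = Suc (n - 1 - k)" using k by linarith+
    have "f (2 * k + 1)
        = real (n choose (2 * k + 1)) * (2 * sqrt 2 * (sqrt 2 ^ (2 * k) * 2 ^ (n - 1 - 2 * k)))"
      unfolding f_def n by simp
    then show "f (2 * k + 1) = sqrt 2 * (real (n choose (2 * k + 1)) * 2 ^ (n - k))"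
      unfolding n sqrt2_even_power[OF k(1)] by simp
  qed simp
  also have "\<dots> = sqrt 2 * real ?s" by (simp add: sum_distrib_left)
  finally have b: "((2 + sqrt 2) ^ n - (2 - sqrt 2) ^ n) / sqrt 2 = real ?s" by simp
  have "(\<Sum>k<(n + 1) div 2. (n choose (2 * k + 1)) * 2 ^ (n + 2 - k)) = 4 * ?s"
    unfolding sum_distrib_left
  proof (rule sum.cong)
    fix k assume "k \<in> {..<(n + 1) div 2}"
    then have "n + 2 - k = Suc (Suc (n - k))" by auto
    then show "(n choose (2 * k + 1)) * 2 ^ (n + 2 - k) = 4 * ((n choose (2 * k + 1)) * 2 ^ (n - k))"
      by simp
  qed simp
  moreover have "d_seq (n + 2) = 2 * a_seq (n + 1)
      + (\<Sum>k<(n + 1) div 2. (n choose (2 * k + 1)) * 2 ^ (n + 2 - k))"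
    by (simp add: d_seq_def)
  ultimately have "d_seq (n + 2) = 2 * a_seq (n + 1) + 4 * ?s" by simp
  then show ?thesis
    unfolding b using a_seq_closed_form[of "n + 1"] by simp
qed

lemma power_recurrence:
  fixes x :: real
  assumes "x\<^sup>2 = 4 * x - 2"
  shows "x ^ (n + 2) = 4 * x ^ (n + 1) - 2 * x ^ n"
proof -
  have "x ^ (n + 2) = x ^ n * x\<^sup>2" by (rule power_add)
  then show ?thesis unfolding assms by (simp add: algebra_simps)
qed

text \<open>The numbers 2 + sqrt 2 and 2 - sqrt 2 are the roots of z^2 = 4z - 2, the characteristic
  equation of the leaf recurrence at t = 1.\<close>

lemma sqrt2_recurrence:
  "(2 + sqrt 2) ^ (n + 2) = 4 * (2 + sqrt 2) ^ (n + 1) - 2 * (2 + sqrt 2) ^ n"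
  "(2 - sqrt 2) ^ (n + 2) = 4 * (2 - sqrt 2) ^ (n + 1) - 2 * (2 - sqrt 2) ^ n"
  by (rule power_recurrence, simp add: power2_eq_square algebra_simps)+

lemma a_seq_recurrence: "int (a_seq (n + 2)) = 4 * int (a_seq (n + 1)) - 2 * int (a_seq n)"
proof -
  have "real (a_seq (n + 2)) = 4 * real (a_seq (n + 1)) - 2 * real (a_seq n)"
    unfolding a_seq_closed_form sqrt2_recurrence by (simp add: field_simps)
  then show ?thesis by linarith
qed

lemma d_seq_recurrence: "int (d_seq (n + 4)) = 4 * int (d_seq (n + 3)) - 2 * int (d_seq (n + 2))"
proof -
  define A B D where "A k = (2 + sqrt 2) ^ k" and "B k = (2 - sqrt 2) ^ k"
    and "D k = (A k - B k) / sqrt 2" for k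
  have rec: "A (k + 2) = 4 * A (k + 1) - 2 * A k" "B (k + 2) = 4 * B (k + 1) - 2 * B k" for k
    unfolding A_def B_def by (rule sqrt2_recurrence)+
  have D: "D (k + 2) = 4 * D (k + 1) - 2 * D k" for k
    unfolding D_def rec by (simp add: diff_divide_distrib)
  have d: "real (d_seq (k + 2)) = A (k + 1) + B (k + 1) + 4 * D k" for k
    unfolding A_def B_def D_def by (rule d_seq_closed_form)
  have "real (d_seq (n + 3)) = A (n + 2) + B (n + 2) + 4 * D (n + 1)"
    "real (d_seq (n + 4)) = A (n + 3) + B (n + 3) + 4 * D (n + 2)"
    "A (n + 3) = 4 * A (n + 2) - 2 * A (n + 1)" "B (n + 3) = 4 * B (n + 2) - 2 * B (n + 1)"
    using d[of "n + 1"] d[of "n + 2"] rec[of "n + 1"] by (simp_all add: eval_nat_numeral)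
  then have "real (d_seq (n + 4)) = 4 * real (d_seq (n + 3)) - 2 * real (d_seq (n + 2))"
    using d[of n] D[of n] by (simp only:) argo
  then show ?thesis by linarith
qed

lemma a_seq_values: "a_seq 0 = 1" "a_seq 1 = 2" "a_seq 2 = 6" "a_seq 3 = 20" "a_seq 4 = 68"
proof -
  show 0: "a_seq 0 = 1" "a_seq 1 = 2" by (simp_all add: a_seq_def)
  show 2: "a_seq 2 = 6" using a_seq_recurrence[of 0] 0 by (simp add: numeral_2_eq_2)
  show 3: "a_seq 3 = 20" using a_seq_recurrence[of 1] 0 2 by (simp add: numeral_3_eq_3 numeral_2_eq_2)
  show "a_seq 4 = 68" using a_seq_recurrence[of 2] 2 3 by simp
qed

text \<open>The values at 2 and 3 belong to degenerate diagrams, two isolated vertices and a path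
  with three vertices, from which the count in type D starts.\<close>

lemma d_seq_values: "d_seq 2 = 4" "d_seq 3 = 20" "d_seq 4 = 72" "d_seq 5 = 248"
proof -
  show 2: "d_seq 2 = 4" "d_seq 3 = 20" using a_seq_values by (simp_all add: d_seq_def)
  show 4: "d_seq 4 = 72" using d_seq_recurrence[of 0] 2 by (simp add: numeral_2_eq_2)
  show "d_seq 5 = 248" using d_seq_recurrence[of 1] 2 4 by (simp add: eval_nat_numeral)
qed

lemma e_values: "e6 = 856" "e7 = 2928" "e8 = 10000"
  by (simp_all add: e6_def e7_def e8_def a_seq_values d_seq_values)

section \<open>Small diagrams and paths\<close>

lemma finite_type_singleton:
  assumes "coxeter_matrix {x} M"
  shows "finite_type {x} M"
proof -
  interpret coxeter "{x}" M by unfold_locales (rule assms)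
  have "coxeter_eq {x} M w [] \<or> coxeter_eq {x} M w [x]" if "set w \<subseteq> {x}" for w
    using that
  proof (induction w)
    case (Cons y w)
    then have "y = x" "coxeter_eq {x} M w [] \<or> coxeter_eq {x} M w [x]" by auto
    then show ?case using Cons_word_eq_iff[of x w] Cons_word_eq_iff[of x "[x]" "[]"]
        word_eq_Cons[of w "[]" x] word_eq_Cons[of w "[x]" x] coxeter_eq.trans[of "{x}" M "x # w" "[x, x]" "[]"]
      by auto
  qed simp
  then have "coxeter_class {x} M ` lists {x} \<subseteq> {coxeter_class {x} M [], coxeter_class {x} M [x]}"
    using class_eq_iff by fastforce
  then show ?thesis by (auto simp: finite_type_def coxeter_group_def intro: finite_subset)
qed

lemma pp_singleton:
  assumes "coxeter_matrix {x} M"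
  shows "pp {x} M = [:1, 1:]"
proof -
  interpret coxeter_finite "{x}" M
    by unfold_locales (use assms finite_type_singleton in auto)
  show ?thesis using pp_isolated[of "{x}" x] by (auto simp: pp_empty adj_def)
qed

context coxeter_finite
begin

lemma num_pp_empty: "num_pp {} = 1"
  by (simp add: num_pp_def pp_empty)

lemma num_pp_singleton: "x \<in> I \<Longrightarrow> num_pp {x} = 2"
  using num_pp_isolated[of "{x}" x] by (auto simp: num_pp_empty adj_def)

lemma num_pp_edge: "x \<in> I \<Longrightarrow> y \<in> I \<Longrightarrow> (x, y) \<in> adj M \<Longrightarrow> num_pp {x, y} = 6"
proof -
  assume xy: "x \<in> I" "y \<in> I" "(x, y) \<in> adj M"
  then have "x \<noteq> y" by (auto simp: adj_def)
  then have "{x, y} - {x} = {y}" "{x, y} - {x, y} = {}" by auto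
  moreover have "num_pp {x, y} = 4 * num_pp ({x, y} - {x}) - 2 * num_pp ({x, y} - {x, y})"
    using xy by (intro num_pp_leaf) (auto simp: adj_def)
  ultimately show ?thesis using xy by (simp add: num_pp_empty num_pp_singleton)
qed

end

text \<open>Only adjacency enters, so one computation serves the types A, B, F, H and I_2. The start
  \<open>a\<close> is variable because deleting the left end moves the interval.\<close>

lemma num_pp_path:
  fixes M :: "nat \<Rightarrow> nat \<Rightarrow> enat"
  assumes "coxeter_finite I M" "{a..<a + m} \<subseteq> I"
    and "\<And>i j. i \<in> {a..<a + m} \<Longrightarrow> j \<in> {a..<a + m} \<Longrightarrow> (i, j) \<in> adj M \<longleftrightarrow> j = i + 1 \<or> i = j + 1"
  shows "coxeter_finite.num_pp M {a..<a + m} = int (a_seq m)"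
proof -
  interpret coxeter_finite I M by (rule assms(1))
  show ?thesis
    using assms(2,3)
  proof (induction m arbitrary: a rule: induct_nat_012)
    case 0
    then show ?case using a_seq_values by (simp add: num_pp_empty)
  next
    case 1
    have "{a..<a + Suc 0} = {a}" by auto
    then show ?case using 1 a_seq_values by (simp add: num_pp_singleton)
  next
    case (ge2 m)
    have s: "{a..<a + Suc (Suc m)} - {a} = {Suc a..<Suc a + Suc m}"
      "{a..<a + Suc (Suc m)} - {a, Suc a} = {Suc (Suc a)..<Suc (Suc a) + m}" by auto
    have "num_pp {a..<a + Suc (Suc m)} = 4 * num_pp ({a..<a + Suc (Suc m)} - {a}) - 2 * num_pp ({a..<a + Suc (Suc m)} - {a, Suc a})"
      using ge2.prems by (intro num_pp_leaf) auto
    also have "num_pp ({a..<a + Suc (Suc m)} - {a}) = int (a_seq (Suc m))"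
      unfolding s using ge2.prems by (intro ge2.IH(2)) auto
    also have "num_pp ({a..<a + Suc (Suc m)} - {a, Suc a}) = int (a_seq m)"
      unfolding s using ge2.prems by (intro ge2.IH(1)) auto
    finally show ?case using a_seq_recurrence[of m] by simp
  qed
qed

section \<open>The classified types\<close>


lemma doubleton_mem_path_edges:
  "{i, j} \<in> path_edges n \<longleftrightarrow> (j = i + 1 \<and> 1 \<le> i \<and> i < n) \<or> (i = j + 1 \<and> 1 \<le> j \<and> j < n)"
proof
  assume "{i, j} \<in> path_edges n"
  then obtain k where "{i, j} = {k, k + 1}" "1 \<le> k" "k < n" by (auto simp: path_edges_def)
  then show "(j = i + 1 \<and> 1 \<le> i \<and> i < n) \<or> (i = j + 1 \<and> 1 \<le> j \<and> j < n)"
    by (auto simp: doubleton_eq_iff)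
next
  assume "(j = i + 1 \<and> 1 \<le> i \<and> i < n) \<or> (i = j + 1 \<and> 1 \<le> j \<and> j < n)"
  then show "{i, j} \<in> path_edges n"
  proof
    assume "i = j + 1 \<and> 1 \<le> j \<and> j < n"
    then show ?thesis unfolding path_edges_def by (intro CollectI exI[of _ j]) auto
  qed (auto simp: path_edges_def)
qed

lemma labeled_graph_adj:
  assumes "labeled_graph I M E L" "i \<in> I" "j \<in> I"
  shows "(i, j) \<in> adj M \<longleftrightarrow> {i, j} \<in> E"
proof -
  interpret coxeter I M using assms(1) by unfold_locales (simp add: labeled_graph_def)
  show ?thesis using doubleton_mem_coxeter_edges[of I i j] assms by (auto simp: labeled_graph_def)
qed

lemma path_type_adj:
  assumes "standard_labeling n M" "\<not> type_D n M" "\<not> type_E n M" "i \<in> {1..n}" "j \<in> {1..n}"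
  shows "(i, j) \<in> adj M \<longleftrightarrow> j = i + 1 \<or> i = j + 1"
proof -
  \<comment> \<open>Brings type I_2, whose edge set is given explicitly, under the description by
    paths.\<close>
  have "path_edges 2 = {{1, 2}}" by (auto simp: path_edges_def intro!: exI[of _ "1::nat"])
  then obtain L where "labeled_graph {1..n} M (path_edges n) L"
    using assms(1-3)
    by (auto simp: standard_labeling_def type_A_def type_B_def type_F_def type_H_def type_I2_def)
  then show ?thesis
    using labeled_graph_adj[OF _ assms(4,5)] assms(4,5) by (auto simp: doubleton_mem_path_edges)
qed

lemma type_D_adj:
  assumes "type_D n M" "i \<in> {1..n}" "j \<in> {1..n}"
  shows "(i, j) \<in> adj M \<longleftrightarrow>
    (j = i + 1 \<and> j < n) \<or> (i = j + 1 \<and> i < n) \<or> (i + 2 = n \<and> j = n) \<or> (j + 2 = n \<and> i = n)"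
proof -
  have "(i, j) \<in> adj M \<longleftrightarrow> {i, j} \<in> path_edges (n - 2) \<union> {{n - 2, n - 1}, {n - 2, n}}" and "4 \<le> n"
    using assms labeled_graph_adj[OF _ assms(2,3)] by (auto simp: type_D_def)
  moreover have "{i, j} \<in> {{n - 2, n - 1}, {n - 2, n}} \<longleftrightarrow>
    (i = n - 2 \<and> j = n - 1 \<or> i = n - 1 \<and> j = n - 2) \<or> (i = n - 2 \<and> j = n \<or> i = n \<and> j = n - 2)"
    by (auto simp: doubleton_eq_iff)
  moreover have "l < n - 2 \<longleftrightarrow> l + 2 < n" "l = n - 2 \<longleftrightarrow> l + 2 = n" "l = n - 1 \<longleftrightarrow> l + 1 = n" for l
    using \<open>4 \<le> n\<close> by linarith+
  ultimately have "(i, j) \<in> adj M \<longleftrightarrow>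
    (((j = i + 1 \<and> 1 \<le> i \<and> i + 2 < n) \<or> (i = j + 1 \<and> 1 \<le> j \<and> j + 2 < n)) \<or>
    (i + 2 = n \<and> j + 1 = n \<or> i + 1 = n \<and> j + 2 = n) \<or> (i + 2 = n \<and> j = n \<or> i = n \<and> j + 2 = n))"
    by (simp only: Un_iff doubleton_mem_path_edges)
  then show ?thesis
    using assms(2,3) unfolding atLeastAtMost_iff by presburger
qed

lemma type_E_adj:
  assumes "type_E n M" "i \<in> {1..n}" "j \<in> {1..n}"
  shows "(i, j) \<in> adj M \<longleftrightarrow>
    (j = i + 1 \<and> j < n) \<or> (i = j + 1 \<and> i < n) \<or> (i = 3 \<and> j = n) \<or> (j = 3 \<and> i = n)"
proof -
  have "(i, j) \<in> adj M \<longleftrightarrow> {i, j} \<in> path_edges (n - 1) \<union> {{3, n}}" and "6 \<le> n"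
    using assms labeled_graph_adj[OF _ assms(2,3)] by (auto simp: type_E_def)
  moreover have "{i, j} \<in> {{3, n}} \<longleftrightarrow> i = 3 \<and> j = n \<or> i = n \<and> j = 3"
    by (auto simp: doubleton_eq_iff)
  moreover have "l < n - 1 \<longleftrightarrow> l + 1 < n" for l using \<open>6 \<le> n\<close> by linarith
  ultimately have "(i, j) \<in> adj M \<longleftrightarrow>
    (((j = i + 1 \<and> 1 \<le> i \<and> i + 1 < n) \<or> (i = j + 1 \<and> 1 \<le> j \<and> j + 1 < n)) \<or>
    (i = 3 \<and> j = n \<or> i = n \<and> j = 3))"
    by (simp only: Un_iff doubleton_mem_path_edges)
  then show ?thesis
    using assms(2,3) unfolding atLeastAtMost_iff by presburger
qed

text \<open>Deleting left ends leaves the final intervals, which are diagrams of type D on m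
  vertices. The recursion ends at m = 2, two isolated vertices, and at m = 3, a path with centre n -
  2.\<close>

lemma num_pp_type_D:
  assumes D: "type_D n M" and fin: "coxeter_finite {1..n} M" and am: "a + m = n + 1" "2 \<le> m" "1 \<le> a"
  shows "coxeter_finite.num_pp M {a..n} = int (d_seq m)"
proof -
  interpret coxeter_finite "{1..n}" M by (rule fin)
  note adj = type_D_adj[OF D]
  have n: "4 \<le> n" using D by (simp add: type_D_def)
  \<comment> \<open>The bound a + 3 <= n keeps a before the branch vertex n - 2, so a + 1 is its
    only neighbour in the interval.\<close>
  have leaf: "num_pp {a..n} = 4 * num_pp {a + 1..n} - 2 * num_pp {a + 2..n}" if a: "1 \<le> a" "a + 3 \<le> n" for a
  proof -
    have "{a..n} - {a} = {a + 1..n}" "{a..n} - {a, a + 1} = {a + 2..n}" by auto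
    moreover have "num_pp {a..n} = 4 * num_pp ({a..n} - {a}) - 2 * num_pp ({a..n} - {a, a + 1})"
      using a by (intro num_pp_leaf) (auto simp: adj)
    ultimately show ?thesis by simp
  qed
  have two: "num_pp {n - 1..n} = 4"
  proof -
    have "{n - 1..n} - {n} = {n - 1}" using n by auto
    moreover have "num_pp {n - 1..n} = 2 * num_pp ({n - 1..n} - {n})"
      using n by (intro num_pp_isolated) (auto simp: adj)
    ultimately show ?thesis using n by (simp add: num_pp_singleton)
  qed
  have three: "num_pp {n - 2..n} = 20"
  proof -
    have "{n - 2..n} - {n} = {n - 2, n - 1}" "{n - 2..n} - {n, n - 2} = {n - 1}" using n by auto
    moreover have "num_pp {n - 2..n} = 4 * num_pp ({n - 2..n} - {n}) - 2 * num_pp ({n - 2..n} - {n, n - 2})"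
      using n by (intro num_pp_leaf) (auto simp: adj)
    moreover have "num_pp {n - 2, n - 1} = 6" using n by (intro num_pp_edge) (auto simp: adj)
    ultimately show ?thesis using n by (simp add: num_pp_singleton)
  qed
  show ?thesis
    using am
  proof (induction m arbitrary: a rule: less_induct)
    case (less m)
    consider "m = 2" | "m = 3" | "4 \<le> m" using less.prems by linarith
    then show ?case
    proof cases
      case 1
      then have "a = n - 1" using less.prems by simp
      then show ?thesis using two d_seq_values 1 by simp
    next
      case 2
      then have "a = n - 2" using less.prems by simp
      then show ?thesis using three d_seq_values 2 by simp
    next
      case 3
      then obtain k where k: "m = k + 4" by (metis le_add_diff_inverse2)
      then have "num_pp {a + 1..n} = int (d_seq (k + 3))" "num_pp {a + 2..n} = int (d_seq (k + 2))"
        using less.prems less.IH[of "k + 3" "a + 1"] less.IH[of "k + 2" "a + 2"] by auto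
      then show ?thesis using leaf[of a] less.prems k d_seq_recurrence[of k] by simp
    qed
  qed
qed

lemma num_pp_type_E:
  assumes E: "type_E n M" and fin: "coxeter_finite {1..n} M"
  shows "coxeter_finite.num_pp M {1..n} = (if n = 6 then e6 else if n = 7 then e7 else e8)"
proof -
  interpret coxeter_finite "{1..n}" M by (rule fin)
  note adj = type_E_adj[OF E]
  have n: "n = 6 \<or> n = 7 \<or> n = 8" using E by (simp add: type_E_def)
  \<comment> \<open>An initial piece of the path together with the extra vertex n. As far as k < n
    this is A_2 x A_1 for k = 2 and A_4, D_5, E_6, E_7, E_8 for k = 3, ..., 7.\<close>
  let ?S = "\<lambda>k. insert n {1..k}"
  \<comment> \<open>For k >= 2 the vertex k + 2 lies beyond the branch vertex 3, so k + 1 is its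
    only neighbour in the subdiagram.\<close>
  have leaf: "num_pp (?S (k + 2)) = 4 * num_pp (?S (k + 1)) - 2 * num_pp (?S k)" if k: "2 \<le> k" "k + 2 < n" for k
  proof -
    have "?S (k + 2) - {k + 2} = ?S (k + 1)" "?S (k + 2) - {k + 2, k + 1} = ?S k" using k by auto
    moreover have "num_pp (?S (k + 2)) = 4 * num_pp (?S (k + 2) - {k + 2}) - 2 * num_pp (?S (k + 2) - {k + 2, k + 1})"
      using k by (intro num_pp_leaf) (auto simp: adj)
    ultimately show ?thesis by simp
  qed
  have path: "num_pp {1..k} = int (a_seq k)" if "k < n" for k
    using num_pp_path[OF fin, of 1 k] that by (auto simp: adj atLeastLessThanSuc_atLeastAtMost)
  have n6: "6 \<le> n" using n by auto
  have P: "num_pp {1..2} = 6" "num_pp {1..3} = 20"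
    using path[of 2] path[of 3] n6 by (simp_all add: a_seq_values)
  have S2: "num_pp (?S 2) = 12"
  proof -
    have "?S 2 - {n} = {1..2}" using n6 by auto
    moreover have "num_pp (?S 2) = 2 * num_pp (?S 2 - {n})"
      using n6 by (intro num_pp_isolated) (auto simp: adj)
    ultimately show ?thesis using P by simp
  qed
  have S3: "num_pp (?S 3) = 68"
  proof -
    have "?S 3 - {n} = {1..3}" "?S 3 - {n, 3} = {1..2}" using n6 by auto
    moreover have "num_pp (?S 3) = 4 * num_pp (?S 3 - {n}) - 2 * num_pp (?S 3 - {n, 3})"
      using n6 by (intro num_pp_leaf) (auto simp: adj)
    ultimately show ?thesis using P by simp
  qed
  have S4: "num_pp (?S 4) = 248" using leaf[of 2] n6 S2 S3 by simp
  have S5: "num_pp (?S 5) = 856" using leaf[of 3] n6 S3 S4 by simp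
  have S6: "num_pp (?S 6) = 2928" if "7 \<le> n" using leaf[of 4] that S4 S5 by simp
  have S7: "num_pp (?S 7) = 10000" if "8 \<le> n" using leaf[of 5] that S5 S6 by simp
  have S: "{1..n} = ?S (n - 1)" using n6 by auto
  from n show ?thesis
  proof (elim disjE)
    assume "n = 6"
    then show ?thesis unfolding S using S5 e_values by simp
  next
    assume "n = 7"
    then show ?thesis unfolding S using S6 e_values by simp
  next
    assume "n = 8"
    then show ?thesis unfolding S using S7 e_values by simp
  qed
qed

theorem theorem3p74:
  fixes M :: "nat \<Rightarrow> nat \<Rightarrow> enat" and n :: nat
  assumes "2 \<le> n"
    and "coxeter_matrix {1..n} M"
    and "irreducible_coxeter {1..n} M"
    and "finite_type {1..n} M"
    and "standard_labeling n M"
  shows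
    "(let i = (if type_E n M then n - 1 else 1);
          j = (if type_E n M then n - 2 else 2);
          J = {1..n} - {i};
          J' = {1..n} - {i, j}
      in pp {1..n} M = [:1, 1:] * (2 * pp J M - pp J' M))
     \<and> (\<forall>N. type_A 0 N \<longrightarrow> pp {} N = 1)
     \<and> (\<forall>N. type_A 1 N \<longrightarrow> pp {1} N = [:1, 1:])
     \<and> int (card (PPs {1..n} M)) = poly (pp {1..n} M) 1
     \<and> (\<not> type_D n M \<and> \<not> type_E n M \<longrightarrow> card (PPs {1..n} M) = a_seq n)
     \<and> (type_D n M \<longrightarrow> card (PPs {1..n} M) = d_seq n)
     \<and> (type_E n M \<and> n = 6 \<longrightarrow> int (card (PPs {1..n} M)) = e6)
     \<and> (type_E n M \<and> n = 7 \<longrightarrow> int (card (PPs {1..n} M)) = e7)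
     \<and> (type_E n M \<and> n = 8 \<longrightarrow> int (card (PPs {1..n} M)) = e8)
     \<and> e6 = 856 \<and> e7 = 2928 \<and> e8 = 10000"
proof -
  interpret coxeter_finite "{1..n}" M by unfold_locales (fact assms)+
  have num: "int (card (PPs {1..n} M)) = num_pp {1..n}"
    unfolding num_pp_def by (rule card_PPs)
  have rec: "pp {1..n} M = [:1, 1:] * (2 * pp ({1..n} - {i}) M - pp ({1..n} - {i, j}) M)"
    if ij: "i = (if type_E n M then n - 1 else 1)" "j = (if type_E n M then n - 2 else 2)" for i j
  proof -
    \<comment> \<open>In type E the leaf n - 1 ends the arm that grows with n; in all other types
      vertex 1 is a leaf with neighbour 2.\<close>
    consider "type_E n M" | "\<not> type_E n M" "type_D n M" | "\<not> type_E n M" "\<not> type_D n M" by blast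
    then show ?thesis
    proof cases
      case 1
      then have "6 \<le> n" by (auto simp: type_E_def)
      then show ?thesis
        using 1 ij by (intro pp_leaf) (auto simp: type_E_adj)
    next
      case 2
      then have "4 \<le> n" by (simp add: type_D_def)
      then show ?thesis
        using 2 ij by (intro pp_leaf) (auto simp: type_D_adj)
    next
      case 3
      then show ?thesis
        using assms(1) ij by (intro pp_leaf) (auto simp: path_type_adj[OF assms(5)])
    qed
  qed
  have path: "card (PPs {1..n} M) = a_seq n" if "\<not> type_D n M" "\<not> type_E n M"
  proof -
    have "num_pp {1..<1 + n} = int (a_seq n)"
      by (rule num_pp_path[OF coxeter_finite_axioms])
        (use path_type_adj[OF assms(5) that] in \<open>auto simp: atLeastLessThanSuc_atLeastAtMost\<close>)
    then show ?thesis using num by (simp add: atLeastLessThanSuc_atLeastAtMost)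
  qed
  have D: "card (PPs {1..n} M) = d_seq n" if "type_D n M"
    using num num_pp_type_D[OF that coxeter_finite_axioms, of 1 n] assms(1) by simp
  have E: "int (card (PPs {1..n} M)) = (if n = 6 then e6 else if n = 7 then e7 else e8)" if "type_E n M"
    using num num_pp_type_E[OF that coxeter_finite_axioms] by simp
  have "pp {1} N = [:1, 1:]" if "type_A 1 N" for N :: "nat \<Rightarrow> nat \<Rightarrow> enat"
    using that by (intro pp_singleton) (simp add: type_A_def labeled_graph_def)
  then show ?thesis
    unfolding Let_def using rec[OF HOL.refl HOL.refl] path D E e_values pp_empty card_PPs by auto
qed

end
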